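(* There is a polynomial-time computable function $I$, defined on colored prime graphs of twin-width at most $1$ and invariant under color-preserving isomorphism (i.e., $G\cong H$ implies $I(G)=I(H)$), such that for any two colored prime graphs $G,H$ of twin-width at most $1$, if $I(G)=I(H)$ then $G\cong H$ (as colored graphs).
   Context: All graphs are finite and simple. A colored graph is a pair $(G,c)$ with $c$ a map from $V(G)$ to the natural numbers; isomorphisms of colored graphs preserve colors, and the twin-width of a colored graph is that of its underlying graph. A set $M\subseteq V(G)$ is a module if every vertex outside $M$ is adjacent to all or to none of $M$; a module is trivial if it has one vertex or equals $V(G)$; $G$ is prime if all its modules are trivial. Twin-width: for a partition $\mathcal P$ of $V(G)$, the quotient trigraph $G/\mathcal P$ has parts as vertices, black edge between fully adjacent parts, no edge between parts with no edges between them, red edge otherwise; a partition sequence starts at singletons and merges two parts per step until one part remains; width is the maximum red degree over all quotients; twin-width is the minimum width. *)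

theory Defs
  imports
    "Graph_Theory.Pair_Digraph"
    "HOL-Library.Disjoint_Sets"
    "HOL-Computational_Algebra.Polynomial"
begin

section \<open>Colored graphs\<close>

text \<open>
  A finite simple graph is a \<^locale>\<open>pair_graph\<close>: finite, loop-free, and with a symmetric set of
  arcs. A coloring is a total function, but only its values on the vertex set are ever used.
\<close>

type_synonym 'a colored_graph = "'a pair_pre_digraph \<times> ('a \<Rightarrow> nat)"

definition colored_iso :: "'a colored_graph \<Rightarrow> 'b colored_graph \<Rightarrow> bool"  (infix \<open>\<simeq>\<^sub>c\<close> 50) where
  "X \<simeq>\<^sub>c Y \<longleftrightarrow> (case (X, Y) of ((G, c), (H, d)) \<Rightarrow>
     \<exists>f. bij_betw f (pverts G) (pverts H) \<and>
         (\<forall>u \<in> pverts G. \<forall>v \<in> pverts G. (u, v) \<in> parcs G \<longleftrightarrow> (f u, f v) \<in> parcs H) \<and>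
         (\<forall>v \<in> pverts G. d (f v) = c v))"

section \<open>Modules and prime graphs\<close>

text \<open>As usual, modules are nonempty; otherwise the empty set would be a nontrivial module.\<close>

definition is_module :: "'a pair_pre_digraph \<Rightarrow> 'a set \<Rightarrow> bool" where
  "is_module G M \<longleftrightarrow> M \<subseteq> pverts G \<and> M \<noteq> {} \<and>
     (\<forall>v \<in> pverts G - M. (\<forall>u \<in> M. (v, u) \<in> parcs G) \<or> (\<forall>u \<in> M. (v, u) \<notin> parcs G))"

definition trivial_module :: "'a pair_pre_digraph \<Rightarrow> 'a set \<Rightarrow> bool" where
  "trivial_module G M \<longleftrightarrow> card M = 1 \<or> M = pverts G"

definition prime_graph :: "'a pair_pre_digraph \<Rightarrow> bool" where
  "prime_graph G \<longleftrightarrow> (\<forall>M. is_module G M \<longrightarrow> trivial_module G M)"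

section \<open>Twin-width\<close>

record 'a trigraph =
  tri_verts :: "'a set"
  black_arcs :: "('a \<times> 'a) set"
  red_arcs :: "('a \<times> 'a) set"

definition quotient_trigraph :: "'a pair_pre_digraph \<Rightarrow> 'a set set \<Rightarrow> 'a set trigraph" where
  "quotient_trigraph G P = \<lparr>
     tri_verts = P,
     black_arcs = {(A, B). A \<in> P \<and> B \<in> P \<and> A \<noteq> B \<and> A \<times> B \<subseteq> parcs G},
     red_arcs = {(A, B). A \<in> P \<and> B \<in> P \<and> A \<noteq> B \<and>
                   \<not> A \<times> B \<subseteq> parcs G \<and> A \<times> B \<inter> parcs G \<noteq> {}} \<rparr>"

definition red_degree :: "'a trigraph \<Rightarrow> 'a \<Rightarrow> nat" where
  "red_degree T x = card {y \<in> tri_verts T. (x, y) \<in> red_arcs T}"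

definition max_red_degree :: "'a trigraph \<Rightarrow> nat" where
  "max_red_degree T = (SUP x \<in> tri_verts T. red_degree T x)"

definition merge_step :: "'a set set \<Rightarrow> 'a set set \<Rightarrow> bool" where
  "merge_step P Q \<longleftrightarrow> (\<exists>A \<in> P. \<exists>B \<in> P. A \<noteq> B \<and> Q = insert (A \<union> B) (P - {A, B}))"

text \<open>
  The final condition is \<open>\<le> 1\<close> rather than \<open>= 1\<close> so that the empty graph, whose only partition has
  no parts, has a partition sequence too; for nonempty graphs there is no difference.
\<close>

definition partition_sequence :: "'a pair_pre_digraph \<Rightarrow> 'a set set list \<Rightarrow> bool" where
  "partition_sequence G Ps \<longleftrightarrow> Ps \<noteq> [] \<and> hd Ps = (\<lambda>v. {v}) ` pverts G \<and>
     (\<forall>P \<in> set Ps. partition_on (pverts G) P) \<and>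
     successively merge_step Ps \<and> card (last Ps) \<le> 1"

definition sequence_width :: "'a pair_pre_digraph \<Rightarrow> 'a set set list \<Rightarrow> nat" where
  "sequence_width G Ps = (SUP P \<in> set Ps. max_red_degree (quotient_trigraph G P))"

definition twin_width :: "'a pair_pre_digraph \<Rightarrow> nat" where
  "twin_width G = (INF Ps \<in> {Ps. partition_sequence G Ps}. sequence_width G Ps)"

definition prime_tww1 :: "'a colored_graph \<Rightarrow> bool" where
  "prime_tww1 X \<longleftrightarrow> pair_graph (fst X) \<and> prime_graph (fst X) \<and> twin_width (fst X) \<le> 1"

section \<open>Polynomial time\<close>

text \<open>
  The machine model is a random access machine with a structured instruction set. The memory
  consists of arrays \<open>0, 1, 2, \<dots>\<close> of natural numbers, only finitely many of which are named by a
  program. The only arithmetic operations are addition and truncated subtraction, at unit cost.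
  One step increases the bit length of the largest number in memory by at most a constant that
  depends on the program, so that the model and multitape Turing machines simulate each other with
  polynomial overhead. (With unit-cost multiplication this would fail.)
\<close>

datatype expr =
    Const nat
  | Read nat expr       \<comment> \<open>array name, index\<close>
  | Plus expr expr
  | Minus expr expr     \<comment> \<open>truncated subtraction\<close>

datatype prog =
    Skip
  | Write nat expr expr \<comment> \<open>array name, index, value\<close>
  | Seq prog prog
  | If expr prog prog   \<comment> \<open>nonzero is true\<close>
  | While expr prog     \<comment> \<open>nonzero is true\<close>

type_synonym memory = "nat \<Rightarrow> nat \<Rightarrow> nat"

primrec eval_expr :: "expr \<Rightarrow> memory \<Rightarrow> nat" where
  "eval_expr (Const n) m = n"
| "eval_expr (Read a i) m = m a (eval_expr i m)"
| "eval_expr (Plus e f) m = eval_expr e m + eval_expr f m"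
| "eval_expr (Minus e f) m = eval_expr e m - eval_expr f m"

text \<open>
  \<open>exec p m t m'\<close>: started in memory \<open>m\<close>, the program \<open>p\<close> halts after \<open>t\<close> steps in memory \<open>m'\<close>.
  Each execution of a \<open>Skip\<close>, of a \<open>Write\<close> and of a test is one step. Evaluating an expression is
  not charged separately, since the size of the expressions is bounded by the size of the program.
\<close>

inductive exec :: "prog \<Rightarrow> memory \<Rightarrow> nat \<Rightarrow> memory \<Rightarrow> bool" where
  exec_Skip: "exec Skip m 1 m"
| exec_Write: "exec (Write a i e) m 1 (m(a := (m a)(eval_expr i m := eval_expr e m)))"
| exec_Seq: "exec p m t m' \<Longrightarrow> exec q m' t' m'' \<Longrightarrow> exec (Seq p q) m (t + t') m''"
| exec_If_true: "eval_expr e m \<noteq> 0 \<Longrightarrow> exec p m t m' \<Longrightarrow> exec (If e p q) m (t + 1) m'"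
| exec_If_false: "eval_expr e m = 0 \<Longrightarrow> exec q m t m' \<Longrightarrow> exec (If e p q) m (t + 1) m'"
| exec_While_true: "eval_expr e m \<noteq> 0 \<Longrightarrow> exec p m t m' \<Longrightarrow> exec (While e p) m' t' m'' \<Longrightarrow>
    exec (While e p) m (t + t' + 1) m''"
| exec_While_false: "eval_expr e m = 0 \<Longrightarrow> exec (While e p) m 1 m"

text \<open>
  Input and output are bit strings, stored in array \<open>0\<close> from index \<open>0\<close> on with \<open>1\<close> for \<open>False\<close>,
  \<open>2\<close> for \<open>True\<close>, and \<open>0\<close> as end marker. Thus a program has to write its output bit by bit. All
  memory other than the input is initially \<open>0\<close>.
\<close>

definition bit_cell :: "bool \<Rightarrow> nat" where
  "bit_cell b = (if b then 2 else 1)"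

definition input_memory :: "bool list \<Rightarrow> memory" where
  "input_memory w = (\<lambda>a i. if a = 0 \<and> i < length w then bit_cell (w ! i) else 0)"

definition output_is :: "memory \<Rightarrow> bool list \<Rightarrow> bool" where
  "output_is m w \<longleftrightarrow> (\<forall>i < length w. m 0 i = bit_cell (w ! i)) \<and> m 0 (length w) = 0"

text \<open>
  The function \<open>f\<close>, with the elements of its domain \<open>D\<close> given as bit strings by \<open>enc\<close>, is computable
  in polynomial time; nothing is required of the program on words that do not encode an element
  of \<open>D\<close>.
\<close>

definition poly_time_computable_on ::
    "'x set \<Rightarrow> ('x \<Rightarrow> bool list) \<Rightarrow> ('x \<Rightarrow> bool list) \<Rightarrow> bool" where
  "poly_time_computable_on D enc f \<longleftrightarrow>
     (\<exists>(p :: prog) (q :: nat poly). \<forall>x \<in> D. \<exists>t m.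
        exec p (input_memory (enc x)) t m \<and> t \<le> poly q (length (enc x)) \<and> output_is m (f x))"

section \<open>Encoding of colored graphs as bit strings\<close>

fun binary_digits :: "nat \<Rightarrow> bool list" where  \<comment> \<open>least significant digit first\<close>
  "binary_digits n = (if n = 0 then [] else odd n # binary_digits (n div 2))"

declare binary_digits.simps [simp del]

text \<open>Self-delimiting: each digit is preceded by \<open>True\<close>, and \<open>False\<close> ends the number.\<close>

definition encode_nat :: "nat \<Rightarrow> bool list" where
  "encode_nat n = concat (map (\<lambda>b. [True, b]) (binary_digits n)) @ [False]"

text \<open>
  The number of vertices, then each vertex followed by its color, all in binary, then the rows of
  the adjacency matrix, with the vertices in increasing order.
\<close>

definition encode_graph :: "nat colored_graph \<Rightarrow> bool list" where
  "encode_graph X = (case X of (G, c) \<Rightarrow>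
     let vs = sorted_list_of_set (pverts G) in
       encode_nat (length vs) @
       concat (map (\<lambda>v. encode_nat v @ encode_nat (c v)) vs) @
       concat (map (\<lambda>u. map (\<lambda>v. (u, v) \<in> parcs G) vs) vs))"

end

theory Submission
  imports Defs
begin

text \<open>
  Reading a partition sequence of width at most 1 backwards, one keeps two linear orders of the parts
  such that parts are adjacent iff the orders disagree on them, with red pairs consecutive in one of
  the orders; at the end, \<open>G\<close> is a permutation graph. In the first order, \<open>x < y\<close> implies \<open>x < z\<close>
  whenever \<open>xy\<close> and \<open>xz\<close> agree in adjacency and \<open>yz\<close> differs from them, and likewise on the other side
  (Gallai's forcing). Start with \<open>a < x\<close> for a single vertex \<open>a\<close> and all \<open>x \<noteq> a\<close>, and close under
  forcing and transitivity. In a prime graph the result is total, because the components of its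
  incomparability graph are modules; and it is irreflexive if \<open>a\<close> is the first vertex of the first
  order. So trying all \<open>a\<close> gives a nonempty, isomorphism invariant set of at most \<open>n\<close> vertex
  orderings, and the invariant is the largest of the encodings of the colored graph along them.
\<close>

section \<open>Graphs of twin-width at most 1 are permutation graphs\<close>

text \<open>A vertex is guessed rather than a pair because this makes totality automatic: every pair
  with \<open>a\<close> is ordered from the outset, so \<open>a\<close> is isolated in the
  incomparability graph, and no component containing another vertex is all of V; primality leaves
  only singletons. Hence for every \<open>a\<close> the closure is total and transitive, and the one
  property that may fail is irreflexivity, which can be read off the diagonal. Which
  \<open>a\<close> succeed is determined by the graph alone, hence invariant; the two orders p and q
  only have to guarantee that one succeeds. On the twin-width side the obstacle is a merged part W
  with a red neighbour Y: once W is split into A and B, each of the pairs AB, AY, BY may be red. Two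
  orders have room for all three, since A, Y, B can be made consecutive in p while A and B are
  consecutive in q. A second red neighbour of W would have to be accommodated in the same way, and
  here width at most 1 enters.\<close>

definition mixed :: "'a rel \<Rightarrow> 'a set \<Rightarrow> 'a set \<Rightarrow> bool" where
  "mixed E A B \<longleftrightarrow> \<not> A \<times> B \<subseteq> E \<and> A \<times> B \<inter> E \<noteq> {}"

definition consecutive :: "('b \<Rightarrow> int) \<Rightarrow> 'b set \<Rightarrow> 'b \<Rightarrow> 'b \<Rightarrow> bool" where
  "consecutive p P A B \<longleftrightarrow> (\<forall>C \<in> P - {A, B}. p C < p A \<longleftrightarrow> p C < p B)"

text \<open>
  Two orders \<open>p\<close> and \<open>q\<close> of the parts represent the trigraph: parts are joined by a black edge iff
  \<open>p\<close> and \<open>q\<close> disagree on them. Exchanging two parts that are consecutive in one order changes only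
  their own adjacency, so a red edge is represented by consecutiveness.
\<close>

definition permutation_diagram ::
    "'a rel \<Rightarrow> 'a set set \<Rightarrow> ('a set \<Rightarrow> int) \<Rightarrow> ('a set \<Rightarrow> int) \<Rightarrow> bool" where
  "permutation_diagram E P p q \<longleftrightarrow> inj_on p P \<and> inj_on q P \<and>
     (\<forall>A \<in> P. \<forall>B \<in> P. A \<noteq> B \<longrightarrow>
        (A \<times> B \<subseteq> E \<longrightarrow> (p A < p B) \<noteq> (q A < q B)) \<and>
        (A \<times> B \<inter> E = {} \<longrightarrow> (p A < p B) = (q A < q B)) \<and>
        (mixed E A B \<longrightarrow> consecutive p P A B \<or> consecutive q P A B))"

definition mixed_matching :: "'a rel \<Rightarrow> 'a set set \<Rightarrow> bool" where
  "mixed_matching E P \<longleftrightarrow> (\<forall>A \<in> P. \<forall>B \<in> P. \<forall>C \<in> P.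
     A \<noteq> B \<longrightarrow> A \<noteq> C \<longrightarrow> mixed E A B \<longrightarrow> mixed E A C \<longrightarrow> B = C)"

lemma mixed_sym: "sym E \<Longrightarrow> mixed E A B \<longleftrightarrow> mixed E B A"
  unfolding mixed_def sym_def by blast

lemma consecutive_sym: "consecutive p P A B \<longleftrightarrow> consecutive p P B A"
  unfolding consecutive_def by blast

lemma permutation_diagram_swap:
  "permutation_diagram E P p q \<Longrightarrow> permutation_diagram E P q p"
  unfolding permutation_diagram_def by blast

text \<open>Exchanging A and B negates both comparisons of positions and, as E is symmetric, keeps
  the kind of the pair. So one orientation of each pair is enough; T selects it.\<close>

lemma permutation_diagram_symI:
  assumes "sym E" "inj_on p P" "inj_on q P" "{} \<notin> P"
    and "\<And>A B. A \<in> P \<Longrightarrow> B \<in> P \<Longrightarrow> A \<noteq> B \<Longrightarrow> T A B \<or> T B A"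
    and "\<And>A B. A \<in> P \<Longrightarrow> B \<in> P \<Longrightarrow> A \<noteq> B \<Longrightarrow> T A B \<Longrightarrow>
      (A \<times> B \<subseteq> E \<longrightarrow> (p A < p B) \<noteq> (q A < q B)) \<and>
      (A \<times> B \<inter> E = {} \<longrightarrow> (p A < p B) = (q A < q B)) \<and>
      (mixed E A B \<longrightarrow> consecutive p P A B \<or> consecutive q P A B)"
  shows "permutation_diagram E P p q"
  unfolding permutation_diagram_def
proof (intro conjI ballI impI, goal_cases)
  case (3 A B)
  have *: "p A \<noteq> p B" "q A \<noteq> q B" using assms(2,3) 3 by (auto dest: inj_onD)
  have "B \<times> A \<subseteq> E" using 3(4) assms(1) by (auto dest: symD)
  then show ?case using assms(5)[of A B] assms(6)[of A B] assms(6)[of B A] 3 * by auto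
next
  case (4 A B)
  have *: "p A \<noteq> p B" "q A \<noteq> q B" using assms(2,3) 4 by (auto dest: inj_onD)
  have "B \<times> A \<inter> E = {}" using 4(4) assms(1) by (auto dest: symD)
  then show ?case using assms(5)[of A B] assms(6)[of A B] assms(6)[of B A] 4 * by auto
next
  case (5 A B)
  then show ?case using assms(5)[of A B] assms(6)[of A B] assms(6)[of B A]
    mixed_sym[OF assms(1), of A B] consecutive_sym[of p P A B] consecutive_sym[of q P A B] by blast
qed (use assms in auto)

text \<open>
  When \<open>W\<close> is split into \<open>A\<close> and \<open>B\<close>, these are put on the two sides of \<open>Y\<close> in \<open>p\<close> and of \<open>W\<close> in \<open>q\<close>,
  where \<open>Y\<close> is the red neighbour of \<open>W\<close>, or \<open>W\<close> itself if there is none. Scaling the old positions by 4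
  makes room for them.
\<close>

lemma permutation_diagram_split:
  assumes E: "sym E"
    and P: "{} \<notin> P" "A \<in> P" "B \<in> P" "A \<noteq> B"
    and W: "W = A \<union> B" "W \<notin> P" and Q: "Q = insert W (P - {A, B})"
    and diag: "permutation_diagram E Q p q"
    and Y: "Y \<in> Q" "Y = W \<or> mixed E Y W"
    and base: "\<And>C. C \<in> P - {A, B, Y} \<Longrightarrow> (p C < p Y \<longleftrightarrow> p C < p W) \<and> \<not> mixed E C W"
    and matching: "\<And>C D. \<lbrakk>C \<in> Q; D \<in> Q; C \<noteq> D; mixed E C D; C = Y \<or> C = W\<rbrakk> \<Longrightarrow> D = Y \<or> D = W"
  shows "\<exists>p q. permutation_diagram E P p q"
proof -
  define s where "s = (q Y < q W)"
  \<comment> \<open>The side of Y on which A stands in \<open>p'\<close>. As Y and W are mixed, A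
    and B are neither both full nor both empty towards Y, so one of them can be made adjacent to Y
    and the other not. The sign makes A the adjacent one iff A is full or B is empty towards Y. For
    Y = W either sign would do.\<close>
  define \<alpha> :: int where "\<alpha> = (if (Y \<times> A \<subseteq> E \<or> Y \<times> B \<inter> E = {}) = s then -1 else 1)"
  \<comment> \<open>With the order of A and B in \<open>p'\<close> fixed by \<alpha>, this sign
    reverses it in \<open>q'\<close> iff A and B are completely adjacent.\<close>
  define \<beta> :: int where "\<beta> = (if (A \<times> B \<subseteq> E) = (\<alpha> > 0) then -1 else 1)"
  have \<alpha>: "\<alpha> = 1 \<or> \<alpha> = -1" and \<beta>: "\<beta> = 1 \<or> \<beta> = -1" by (auto simp: \<alpha>_def \<beta>_def)
  define p' where "p' = (\<lambda>C. if C = A then 4 * p Y + \<alpha> else if C = B then 4 * p Y - \<alpha> else 4 * p C)"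
  define q' where "q' = (\<lambda>C. if C = A then 4 * q W + \<beta> else if C = B then 4 * q W - \<beta> else 4 * q C)"
  have p'[simp]: "p' A = 4 * p Y + \<alpha>" "p' B = 4 * p Y - \<alpha>"
    and q'[simp]: "q' A = 4 * q W + \<beta>" "q' B = 4 * q W - \<beta>" using P by (auto simp: p'_def q'_def)
  have p'o[simp]: "p' C = 4 * p C" and q'o[simp]: "q' C = 4 * q C" if "C \<in> P - {A, B}" for C
    using that by (auto simp: p'_def q'_def)
  have inj: "inj_on p Q" "inj_on q Q" using diag by (auto simp: permutation_diagram_def)
  have pne: "p C \<noteq> p Y" if "C \<in> P - {A, B, Y}" for C
    using inj_onD[OF inj(1), of C Y] that Y(1) Q by blast
  have qne: "q C \<noteq> q W" if "C \<in> P - {A, B}" for C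
    using inj_onD[OF inj(2), of C W] that W(2) Q by blast
  have \<alpha>A: "p' C < p' A \<longleftrightarrow> p C < p Y" "p' C < p' B \<longleftrightarrow> p C < p Y" "p' A < p' C \<longleftrightarrow> p Y < p C"
    "p' B < p' C \<longleftrightarrow> p Y < p C"
    if "C \<in> P - {A, B, Y}" for C
    using pne[OF that] \<alpha> that by auto
  have \<beta>A: "q' C < q' A \<longleftrightarrow> q C < q W" "q' C < q' B \<longleftrightarrow> q C < q W" "q' A < q' C \<longleftrightarrow> q W < q C"
    "q' B < q' C \<longleftrightarrow> q W < q C"
    if "C \<in> P - {A, B}" for C
    using qne[OF that] \<beta> that by auto
  have W_full: "C \<times> W \<subseteq> E \<longleftrightarrow> C \<times> A \<subseteq> E \<and> C \<times> B \<subseteq> E" for C using W by auto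
  have W_empty: "C \<times> W \<inter> E = {} \<longleftrightarrow> C \<times> A \<inter> E = {} \<and> C \<times> B \<inter> E = {}" for C using W by auto
  have ne: "C \<times> D \<noteq> {}" if "C \<in> P" "D \<in> P" for C D using P that by auto
  have Yin: "Y \<in> P - {A, B}" if "Y \<noteq> W" using that Y Q by auto
  have mod4: "4 * x + \<gamma> \<noteq> 4 * y" "4 * x - \<gamma> \<noteq> 4 * y" "x + \<gamma> \<noteq> x - \<gamma>"
    if "\<gamma> = 1 \<or> \<gamma> = -1" for x y \<gamma> :: int
    using that by presburger+
  have inj': "inj_on p' P"
  proof (rule inj_onI)
    fix C D assume *: "C \<in> P" "D \<in> P" "p' C = p' D"
    then show "C = D"
      using mod4[OF \<alpha>] mod4[OF \<alpha>, symmetric] inj_onD[OF inj(1), of C D] Q P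
      by (cases "C = A"; cases "C = B"; cases "D = A"; cases "D = B") (auto simp: p'_def)
  qed
  have injq': "inj_on q' P"
  proof (rule inj_onI)
    fix C D assume *: "C \<in> P" "D \<in> P" "q' C = q' D"
    then show "C = D"
      using mod4[OF \<beta>] mod4[OF \<beta>, symmetric] inj_onD[OF inj(2), of C D] Q P
      by (cases "C = A"; cases "C = B"; cases "D = A"; cases "D = B") (auto simp: q'_def)
  qed
  have out: "(C \<times> U \<subseteq> E \<longrightarrow> (p' C < p' U) \<noteq> (q' C < q' U)) \<and>
      (C \<times> U \<inter> E = {} \<longrightarrow> (p' C < p' U) = (q' C < q' U)) \<and>
      (mixed E C U \<longrightarrow> consecutive p' P C U \<or> consecutive q' P C U)"
    if C: "C \<in> P - {A, B}" and U: "U = A \<or> U = B" for C U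
  proof (cases "C = Y")
    case True
    have YW: "Y \<noteq> W" using True C W by auto
    then have m: "mixed E Y W" using Y by blast
    have 1: "(Y \<times> U \<subseteq> E \<longrightarrow> (p' Y < p' U) \<noteq> (q Y < q W)) \<and> (Y \<times> U \<inter> E = {} \<longrightarrow> (p' Y < p' U) = (q Y < q W))"
    proof -
      have "\<not> (Y \<times> A \<subseteq> E \<and> Y \<times> B \<subseteq> E)" "\<not> (Y \<times> A \<inter> E = {} \<and> Y \<times> B \<inter> E = {})"
        using m W_full[of Y] W_empty[of Y] unfolding mixed_def by blast+
      moreover have "\<not> (Y \<times> A \<subseteq> E \<and> Y \<times> A \<inter> E = {})" "\<not> (Y \<times> B \<subseteq> E \<and> Y \<times> B \<inter> E = {})"
        using ne[of Y A] ne[of Y B] Yin[OF YW] P by blast+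
      moreover have "p' Y < p' A \<longleftrightarrow> 0 < \<alpha>" "p' Y < p' B \<longleftrightarrow> \<not> 0 < \<alpha>"
        using \<alpha> p'o[OF Yin[OF YW]] by auto
      moreover have "0 < \<alpha> \<longleftrightarrow> (Y \<times> A \<subseteq> E \<or> Y \<times> B \<inter> E = {}) \<noteq> s" by (simp add: \<alpha>_def)
      ultimately show ?thesis using U unfolding s_def by blast
    qed
    have 2: "consecutive p' P Y U"
      unfolding consecutive_def
    proof
      fix D assume D: "D \<in> P - {Y, U}"
      show "p' D < p' Y \<longleftrightarrow> p' D < p' U"
      proof (cases "D = A \<or> D = B")
        case True
        have "p' Y = 4 * p Y" by (rule p'o[OF Yin[OF YW]])
        then have "(p' A < p' Y) = (p' A < p' B)" "(p' B < p' Y) = (p' B < p' A)"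
          unfolding p' using \<alpha> by linarith+
        then show ?thesis using True D U by blast
      next
        case False
        then have "D \<in> P - {A, B, Y}" "D \<in> P - {A, B}" using D by blast+
        then show ?thesis using U \<alpha>A(1,2)[of D] p'o[of D] p'o[OF Yin[OF YW]] by auto
      qed
    qed
    have 3: "(q' Y < q' U) = (q Y < q W)" using \<beta>A(1,2)[OF Yin[OF YW]] U by blast
    show ?thesis using 1 2 3 True by blast
  next
    case False
    then have CY: "C \<in> P - {A, B, Y}" using C by auto
    then have nm: "\<not> mixed E C W" using base by blast
    have CQ: "C \<in> Q" "W \<in> Q" "C \<noteq> W" using Q C W by auto
    have 1: "(p' C < p' U) = (p C < p W)" "(q' C < q' U) = (q C < q W)"
      using \<alpha>A(1,2)[OF CY] \<beta>A(1,2)[OF C] U base[OF CY] by blast+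
    have 2: "C \<times> U \<subseteq> E \<longleftrightarrow> C \<times> W \<subseteq> E" "C \<times> U \<inter> E = {} \<longleftrightarrow> C \<times> W \<inter> E = {}"
    proof -
      have "C \<times> U \<noteq> {}" using ne[of C] C P U by blast
      moreover have "C \<times> U \<subseteq> C \<times> W" using U W by blast
      moreover have "C \<times> W \<subseteq> E \<or> C \<times> W \<inter> E = {}" using nm unfolding mixed_def by blast
      ultimately show "C \<times> U \<subseteq> E \<longleftrightarrow> C \<times> W \<subseteq> E" "C \<times> U \<inter> E = {} \<longleftrightarrow> C \<times> W \<inter> E = {}"
        by blast+
    qed
    then have 3: "\<not> mixed E C U" using nm unfolding mixed_def by blast
    have "(C \<times> W \<subseteq> E \<longrightarrow> (p C < p W) \<noteq> (q C < q W)) \<and>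
      (C \<times> W \<inter> E = {} \<longrightarrow> (p C < p W) = (q C < q W))"
      using diag CQ unfolding permutation_diagram_def by blast
    then show ?thesis unfolding 1 2 using 3 by blast
  qed
  have AB: "(A \<times> B \<subseteq> E \<longrightarrow> (p' A < p' B) \<noteq> (q' A < q' B)) \<and>
      (A \<times> B \<inter> E = {} \<longrightarrow> (p' A < p' B) = (q' A < q' B)) \<and>
      (mixed E A B \<longrightarrow> consecutive p' P A B \<or> consecutive q' P A B)"
  proof -
    have "consecutive q' P A B" unfolding consecutive_def using \<beta>A by blast
    moreover have "\<not> (A \<times> B \<subseteq> E \<and> A \<times> B \<inter> E = {})" using ne[of A B] P by auto
    moreover have "p' A < p' B \<longleftrightarrow> \<not> 0 < \<alpha>" "q' A < q' B \<longleftrightarrow> \<not> 0 < \<beta>"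
      unfolding p' q' using \<alpha> \<beta> by auto
    moreover have "0 < \<beta> \<longleftrightarrow> (A \<times> B \<subseteq> E) \<noteq> (0 < \<alpha>)" by (simp add: \<beta>_def)
    ultimately show ?thesis by argo
  qed
  have CD: "(C \<times> D \<subseteq> E \<longrightarrow> (p' C < p' D) \<noteq> (q' C < q' D)) \<and>
      (C \<times> D \<inter> E = {} \<longrightarrow> (p' C < p' D) = (q' C < q' D)) \<and>
      (mixed E C D \<longrightarrow> consecutive p' P C D \<or> consecutive q' P C D)"
    if C: "C \<in> P - {A, B}" and D: "D \<in> P - {A, B}" and "C \<noteq> D" for C D
  proof -
    have Q': "C \<in> Q" "D \<in> Q" "W \<noteq> C" "W \<noteq> D" using C D Q W by auto
    have *: "(C \<times> D \<subseteq> E \<longrightarrow> (p C < p D) \<noteq> (q C < q D)) \<and>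
      (C \<times> D \<inter> E = {} \<longrightarrow> (p C < p D) = (q C < q D)) \<and>
      (mixed E C D \<longrightarrow> consecutive p Q C D \<or> consecutive q Q C D)"
      using diag Q' \<open>C \<noteq> D\<close> unfolding permutation_diagram_def by blast
    have "consecutive p' P C D \<or> consecutive q' P C D" if m: "mixed E C D"
    proof -
      \<comment> \<open>A red pair of old parts avoids both Y and W, and the new parts stand where Y
        stood in p and where W stood in q. So they do not get between C and D.\<close>
      have CDY: "C \<noteq> Y" "D \<noteq> Y"
        using matching[of C D] matching[of D C] Q' \<open>C \<noteq> D\<close> m mixed_sym[OF E, of C D] by metis+
      have "consecutive p' P C D" if c: "consecutive p Q C D"
        unfolding consecutive_def
      proof
        fix F assume F: "F \<in> P - {C, D}"
        have YQ: "Y \<in> Q - {C, D}" using CDY Y by auto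
        show "p' F < p' C \<longleftrightarrow> p' F < p' D"
        proof (cases "F = A \<or> F = B")
          case True then show ?thesis
            using \<alpha>A(3,4)[of C] \<alpha>A(3,4)[of D] CDY C D c YQ
            unfolding consecutive_def by blast
        next
          case False
          then have "F \<in> P - {A, B}" "F \<in> Q - {C, D}" using F Q by blast+
          then show ?thesis using p'o[of F] p'o[OF C] p'o[OF D] c unfolding consecutive_def by auto
        qed
      qed
      moreover have "consecutive q' P C D" if c: "consecutive q Q C D"
        unfolding consecutive_def
      proof
        fix F assume F: "F \<in> P - {C, D}"
        have YQ: "W \<in> Q - {C, D}" using Q' Q by auto
        show "q' F < q' C \<longleftrightarrow> q' F < q' D"
        proof (cases "F = A \<or> F = B")
          case True then show ?thesis
            using \<beta>A(3,4)[of C] \<beta>A(3,4)[of D] C D c YQ unfolding consecutive_def by blast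
        next
          case False
          then have "F \<in> P - {A, B}" "F \<in> Q - {C, D}" using F Q by blast+
          then show ?thesis using q'o[of F] q'o[OF C] q'o[OF D] c unfolding consecutive_def by auto
        qed
      qed
      ultimately show ?thesis using * m by blast
    qed
    then show ?thesis using * p'o[OF C] p'o[OF D] q'o[OF C] q'o[OF D] by auto
  qed
  have "permutation_diagram E P p' q'"
  proof (rule permutation_diagram_symI[where T = "\<lambda>C D. C \<in> P - {A, B} \<or> (C = A \<and> D = B)"])
    fix C D assume *: "C \<in> P" "D \<in> P" "C \<noteq> D" "C \<in> P - {A, B} \<or> C = A \<and> D = B"
    show "(C \<times> D \<subseteq> E \<longrightarrow> (p' C < p' D) \<noteq> (q' C < q' D)) \<and>
      (C \<times> D \<inter> E = {} \<longrightarrow> (p' C < p' D) = (q' C < q' D)) \<and>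
      (mixed E C D \<longrightarrow> consecutive p' P C D \<or> consecutive q' P C D)"
    proof (cases "D = A \<or> D = B")
      case True
      from *(4) show ?thesis
      proof
        assume "C \<in> P - {A, B}" then show ?thesis using True by (rule out)
      next
        assume "C = A \<and> D = B" then show ?thesis using AB by simp
      qed
    next
      case False
      then have "C \<in> P - {A, B}" "D \<in> P - {A, B}" using * by blast+
      then show ?thesis using *(3) by (rule CD)
    qed
  next
    show "(C \<in> P - {A, B} \<or> C = A \<and> D = B) \<or> (D \<in> P - {A, B} \<or> D = A \<and> C = B)"
      if "C \<in> P" "D \<in> P" "C \<noteq> D" for C D using that by blast
  qed (fact E inj' injq' P)+
  then show ?thesis by blast
qed

text \<open>The matching condition leaves the merged part at most one red neighbour X, and the
  diagram of Q makes the two consecutive in p or in q. Exchanging the orders reduces this to p, with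
  Y = X in the split. Without a red neighbour the part is split in place.\<close>

lemma permutation_diagram_merge_step:
  assumes E: "sym E" and part: "partition_on V P" and step: "merge_step P Q"
    and matching: "mixed_matching E Q"
    and diag: "permutation_diagram E Q p q"
  shows "\<exists>p q. permutation_diagram E P p q"
proof -
  obtain A B where P: "A \<in> P" "B \<in> P" "A \<noteq> B" and Q: "Q = insert (A \<union> B) (P - {A, B})"
    using step unfolding merge_step_def by blast
  have emp: "{} \<notin> P" and dis: "\<And>C D. C \<in> P \<Longrightarrow> D \<in> P \<Longrightarrow> C \<noteq> D \<Longrightarrow> C \<inter> D = {}"
    using part by (auto simp: partition_on_def disjoint_def)
  have W: "A \<union> B \<notin> P"
  proof
    assume "A \<union> B \<in> P"
    then have "A \<union> B = A \<or> (A \<union> B) \<inter> A = {}" "A \<union> B = B \<or> (A \<union> B) \<inter> B = {}"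
      using dis P by blast+
    moreover have "A \<noteq> {}" "B \<noteq> {}" "A \<inter> B = {}" using emp dis P by auto
    ultimately show False by blast
  qed
  have red: "\<And>A B C. \<lbrakk>A \<in> Q; B \<in> Q; C \<in> Q; A \<noteq> B; A \<noteq> C; mixed E A B; mixed E A C\<rbrakk> \<Longrightarrow> B = C"
    using matching unfolding mixed_matching_def by blast
  show ?thesis
  proof (cases "\<exists>X \<in> Q. X \<noteq> A \<union> B \<and> mixed E X (A \<union> B)")
    case False
    show ?thesis
    proof (rule permutation_diagram_split[OF E emp P refl W Q diag, of "A \<union> B"])
      fix C assume "C \<in> P - {A, B, A \<union> B}"
      then show "(p C < p (A \<union> B) \<longleftrightarrow> p C < p (A \<union> B)) \<and> \<not> mixed E C (A \<union> B)"
        using False Q by auto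
    next
      fix C D assume "C \<in> Q" "D \<in> Q" "C \<noteq> D" "mixed E C D" "C = A \<union> B \<or> C = A \<union> B"
      then show "D = A \<union> B \<or> D = A \<union> B" using False mixed_sym[OF E] by blast
    qed (use Q in auto)
  next
    case True
    then obtain X where X: "X \<in> Q" "X \<noteq> A \<union> B" "mixed E X (A \<union> B)" by blast
    have WQ: "A \<union> B \<in> Q" using Q by auto
    have red': "C = X" if "C \<in> Q" "C \<noteq> A \<union> B" "mixed E C (A \<union> B)" for C
      using red[of "A \<union> B" C X] X that WQ mixed_sym[OF E] by blast
    have mat: "D = X \<or> D = A \<union> B"
      if "C \<in> Q" "D \<in> Q" "C \<noteq> D" "mixed E C D" "C = X \<or> C = A \<union> B" for C D
      using that red[of C D "A \<union> B"] red' X WQ mixed_sym[OF E] by blast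
    have key: "\<exists>p q. permutation_diagram E P p q"
      if d: "permutation_diagram E Q p q" and c: "consecutive p Q X (A \<union> B)" for p q
    proof (rule permutation_diagram_split[OF E emp P refl W Q d X(1)])
      fix C assume *: "C \<in> P - {A, B, X}"
      have C: "C \<in> Q - {X, A \<union> B}" using * Q W by auto
      then show "(p C < p X \<longleftrightarrow> p C < p (A \<union> B)) \<and> \<not> mixed E C (A \<union> B)"
        using c red' unfolding consecutive_def by blast
    qed (use X mat in auto)
    have "consecutive p Q X (A \<union> B) \<or> consecutive q Q X (A \<union> B)"
      using diag X WQ unfolding permutation_diagram_def by simp
    then show ?thesis using key diag permutation_diagram_swap by blast
  qed
qed

lemma permutation_diagram_sequence:
  assumes E: "sym E"
    and "Ps \<noteq> []" "\<forall>P \<in> set Ps. partition_on V P" "successively merge_step Ps" "card (last Ps) \<le> 1"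
    and "finite V"
    and "\<forall>Q \<in> set Ps. mixed_matching E Q"
  shows "\<exists>p q. permutation_diagram E (hd Ps) p q"
  using assms(2-5,7)
proof (induction Ps rule: induct_list012)
  case (2 P)
  have "finite P" using 2(2) finite_elements[OF assms(6)] by simp
  moreover have "card P \<le> Suc 0" using 2(4) by simp
  ultimately have "\<forall>A \<in> P. \<forall>B \<in> P. A = B" using card_le_Suc0_iff_eq by blast
  then have "permutation_diagram E P (\<lambda>_. 0) (\<lambda>_. 0)"
    unfolding permutation_diagram_def by (auto intro: inj_onI)
  then show ?case by auto
next
  case (3 P Q Ps)
  from 3(2) obtain p q where pq: "permutation_diagram E Q p q" using 3(4-) by auto
  have "\<exists>p q. permutation_diagram E P p q"
  proof (rule permutation_diagram_merge_step[OF E _ _ _ pq])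
    show "partition_on V P" "merge_step P Q" "mixed_matching E Q" using 3 by simp_all
  qed
  then show ?case by simp
qed simp

section \<open>From twin-width to a permutation representation\<close>

lemma partition_sequence_exists:
  assumes "finite V" "partition_on V P"
  shows "\<exists>Ps. Ps \<noteq> [] \<and> hd Ps = P \<and> (\<forall>P \<in> set Ps. partition_on V P) \<and>
    successively merge_step Ps \<and> card (last Ps) \<le> 1"
  using assms(2)
proof (induction "card P" arbitrary: P rule: less_induct)
  case less
  have fin: "finite P" using less assms(1) finite_elements by auto
  show ?case
  proof (cases "card P \<le> 1")
    case True then show ?thesis using less by (intro exI[of _ "[P]"]) auto
  next
    case False
    then obtain A B where AB: "A \<in> P" "B \<in> P" "A \<noteq> B"
      using fin by (auto simp: card_le_Suc0_iff_eq)
    define Q where "Q = insert (A \<union> B) (P - {A, B})"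
    have step: "merge_step P Q" unfolding merge_step_def Q_def using AB by blast
    have P: "\<Union>P = V" "disjoint P" "{} \<notin> P" using less by (auto simp: partition_on_def)
    have Q: "partition_on V Q"
    proof (rule partition_onI)
      show "\<Union>Q = V" using P(1) AB unfolding Q_def by auto
      show "disjnt p p'" if "p \<in> Q" "p' \<in> Q" "p \<noteq> p'" for p p'
        using that P(2) AB unfolding Q_def disjoint_def disjnt_def by auto
      show "{} \<notin> Q" using P(3) AB unfolding Q_def by auto
    qed
    have "card (P - {A, B}) = card P - 2" using AB fin by (simp add: card_Diff_subset)
    moreover have "card Q \<le> Suc (card (P - {A, B}))"
      using fin unfolding Q_def by (simp add: card_insert_if)
    ultimately have "card Q < card P" using False by simp
    from less(1)[OF this Q] obtain Ps where Ps: "Ps \<noteq> [] \<and> hd Ps = Q \<and>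
      (\<forall>P \<in> set Ps. partition_on V P) \<and> successively merge_step Ps \<and> card (last Ps) \<le> 1" by blast
    then show ?thesis using step less(2)
      by (intro exI[of _ "P # Ps"]) (auto simp: successively_Cons)
  qed
qed

lemma twin_width_le_1_permutation:
  assumes G: "pair_graph G" and tww: "twin_width G \<le> 1"
  obtains p q :: "'a \<Rightarrow> int" where "inj_on p (pverts G)" "inj_on q (pverts G)"
    "\<And>u v. u \<in> pverts G \<Longrightarrow> v \<in> pverts G \<Longrightarrow> u \<noteq> v \<Longrightarrow>
      (u, v) \<in> parcs G \<longleftrightarrow> (p u < p v) \<noteq> (q u < q v)"
proof -
  interpret pair_graph G by fact
  let ?V = "pverts G" and ?E = "parcs G"
  have E: "sym ?E" using pair_sym_arcs by (auto simp: symmetric_def)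
  have fin: "finite ?V" by simp
  have part0: "partition_on ?V ((\<lambda>v. {v}) ` ?V)"
    by (rule partition_onI) (auto simp: disjnt_def)
  \<comment> \<open>The infimum that defines twin-width is attained only over a nonempty set, so a
    bound on it yields an actual sequence once some sequence is known to exist.\<close>
  have "{Ps. partition_sequence G Ps} \<noteq> {}"
    using partition_sequence_exists[OF fin part0] unfolding partition_sequence_def by blast
  then obtain Ps where Ps: "partition_sequence G Ps" and w: "sequence_width G Ps \<le> 1"
    using tww Inf_nat_def1[of "sequence_width G ` {Ps. partition_sequence G Ps}"]
    unfolding twin_width_def by (metis (mono_tags, lifting) empty_is_image imageE mem_Collect_eq)
  have red: "mixed_matching ?E Q" if Q: "Q \<in> set Ps" for Q
    unfolding mixed_matching_def
  proof (intro ballI impI)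
    fix A B C assume *: "A \<in> Q" "B \<in> Q" "C \<in> Q" "A \<noteq> B" "A \<noteq> C" "mixed ?E A B" "mixed ?E A C"
    let ?T = "quotient_trigraph G Q"
    have fQ: "finite Q"
      using Q Ps fin finite_elements unfolding partition_sequence_def by blast
    have "max_red_degree ?T \<le> sequence_width G Ps"
      unfolding sequence_width_def by (rule cSup_upper) (use Q in auto)
    moreover have "red_degree ?T A \<le> max_red_degree ?T"
      unfolding max_red_degree_def
      by (rule cSup_upper) (use * fQ in \<open>auto simp: quotient_trigraph_def\<close>)
    ultimately have "red_degree ?T A \<le> 1" using w by simp
    then have "card {Y \<in> Q. A \<noteq> Y \<and> mixed ?E A Y} \<le> 1"
      unfolding red_degree_def quotient_trigraph_def mixed_def
      using *(1) by (auto elim: order_trans[rotated] intro!: card_mono simp: fQ)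
    then show "B = C" using fQ * by (auto simp: card_le_Suc0_iff_eq)
  qed
  obtain p q where pq: "permutation_diagram ?E ((\<lambda>v. {v}) ` ?V) p q"
    using permutation_diagram_sequence[OF E, of Ps ?V] Ps fin red
    unfolding partition_sequence_def by metis
  show thesis
  proof (rule that[of "\<lambda>v. p {v}" "\<lambda>v. q {v}"])
    show "inj_on (\<lambda>v. p {v}) ?V" "inj_on (\<lambda>v. q {v}) ?V"
      using pq unfolding permutation_diagram_def inj_on_def by auto
    show "(u, v) \<in> ?E \<longleftrightarrow> (p {u} < p {v}) \<noteq> (q {u} < q {v})"
      if "u \<in> ?V" "v \<in> ?V" "u \<noteq> v" for u v
      using pq that unfolding permutation_diagram_def by fastforce
  qed
qed

section \<open>Forced orders and canonical words\<close>

text \<open>The third vertex z may coincide with x or y. For symmetric A this adds nothing: such an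
  instance either contradicts its own conditions or returns the premise. So no distinctness test is
  needed when the closure is computed.\<close>

inductive forced_less :: "'a set \<Rightarrow> ('a \<Rightarrow> 'a \<Rightarrow> bool) \<Rightarrow> 'a \<Rightarrow> 'a \<Rightarrow> 'a \<Rightarrow> bool"
  for V A a where
  forced_start: "x \<in> V \<Longrightarrow> x \<noteq> a \<Longrightarrow> forced_less V A a a x"
| forced_trans: "forced_less V A a x y \<Longrightarrow> forced_less V A a y z \<Longrightarrow> forced_less V A a x z"
| forced_right: "forced_less V A a x y \<Longrightarrow> z \<in> V \<Longrightarrow> A x y = A x z \<Longrightarrow> A x y \<noteq> A y z \<Longrightarrow>
    forced_less V A a x z"
| forced_left: "forced_less V A a x y \<Longrightarrow> z \<in> V \<Longrightarrow> A x y = A z y \<Longrightarrow> A x y \<noteq> A x z \<Longrightarrow>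
    forced_less V A a z y"

lemma forced_less_in:
  assumes "forced_less V A a x y" "a \<in> V"
  shows "x \<in> V" "y \<in> V"
  using assms by (induction) auto

text \<open>The connected components of the incomparability graph are modules, and \<open>{a}\<close> is one of them.\<close>

lemma forced_less_total:
  assumes A: "\<And>x y. x \<in> V \<Longrightarrow> y \<in> V \<Longrightarrow> A x y \<longleftrightarrow> A y x"
    and prime: "\<And>M. \<lbrakk>M \<subseteq> V; M \<noteq> {}; \<forall>v \<in> V - M. (\<forall>u \<in> M. A v u) \<or> (\<forall>u \<in> M. \<not> A v u)\<rbrakk> \<Longrightarrow>
      card M = 1 \<or> M = V"
    and V: "a \<in> V" "x \<in> V" "y \<in> V" "x \<noteq> y"
  shows "forced_less V A a x y \<or> forced_less V A a y x"
proof (rule ccontr)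
  let ?L = "forced_less V A a"
  define R where "R = {(u, v). u \<in> V \<and> v \<in> V \<and> u \<noteq> v \<and> \<not> ?L u v \<and> \<not> ?L v u}"
  assume "\<not> (?L x y \<or> ?L y x)"
  then have xy: "(x, y) \<in> R" using V by (auto simp: R_def)
  define M where "M = {u. (x, u) \<in> R\<^sup>*}"
  have MV: "M \<subseteq> V"
  proof
    fix u assume "u \<in> M"
    then have "(x, u) \<in> R\<^sup>*" by (simp add: M_def)
    then show "u \<in> V" by (induction) (use V in \<open>auto simp: R_def\<close>)
  qed
  have xM: "x \<in> M" and yM: "y \<in> M" using xy by (auto simp: M_def)
  have hom: "A v u = A v x" if v: "v \<in> V - M" and u: "u \<in> M" for v u
  proof -
    have "(x, u) \<in> R\<^sup>*" using u by (simp add: M_def)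
    then show ?thesis
    proof (induction)
      case (step u u')
      have M: "u \<in> M" "u' \<in> M" using step(1,2) by (auto simp: M_def)
      have comp: "?L v w \<or> ?L w v" if "w \<in> M" for w
      proof (rule ccontr)
        assume "\<not> (?L v w \<or> ?L w v)"
        then have "(w, v) \<in> R" using that v MV by (auto simp: R_def)
        then have "v \<in> M" using that by (auto simp: M_def)
        then show False using v by blast
      qed
      have V': "u \<in> V" "u' \<in> V" "v \<in> V" using M MV v by auto
      have n: "\<not> ?L u u'" "\<not> ?L u' u" using step(2) by (auto simp: R_def)
      have s: "A u' u = A u u'" "A u v = A v u" "A u' v = A v u'" using A V' by blast+
      \<comment> \<open>By transitivity v cannot lie between the incomparable u and u', so it
        precedes both or follows both. If its adjacencies to them differed, A u u' would agree with
        one of them, and the corresponding forcing rule would compare u with u'.\<close>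
      have "A v u = A v u'"
      proof (rule ccontr)
        assume ne: "A v u \<noteq> A v u'"
        consider "?L v u" "?L v u'" | "?L u v" "?L u' v" | "?L u v" "?L v u'" | "?L u' v" "?L v u"
          using comp M by blast
        then show False
        proof cases
          case 1
          show ?thesis
            using forced_left[OF 1(1), of u'] forced_left[OF 1(2), of u] V' n ne s by blast
        next
          case 2
          show ?thesis
            using forced_right[OF 2(1), of u'] forced_right[OF 2(2), of u] V' n ne s by blast
        qed (use n forced_trans[of V A a] in blast)+
      qed
      then show ?case using step.IH by simp
    qed simp
  qed
  have "card M = 1 \<or> M = V"
  proof (rule prime[OF MV])
    show "\<forall>v \<in> V - M. (\<forall>u \<in> M. A v u) \<or> (\<forall>u \<in> M. \<not> A v u)" using hom by blast
  qed (use xM in blast)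
  moreover have "card M \<noteq> 1" using xM yM V by (auto simp: card_1_singleton_iff)
  ultimately have "(x, a) \<in> R\<^sup>*" using V by (auto simp: M_def)
  then show False
    by (cases rule: rtranclE) (use xy V forced_start[of _ V a A] in \<open>auto simp: R_def\<close>)
qed

text \<open>In each forcing rule two pairs of the same kind share a vertex. If the conclusion
  failed, that vertex would lie between the other two in p; as both pairs are inverted in q or both
  are not, it would lie between them in q as well, so the third pair would be of the same kind too.
  The starting pairs hold because \<open>a\<close> is minimal in p.\<close>

lemma forced_less_sound:
  fixes p q :: "'a \<Rightarrow> int"
  assumes inj: "inj_on p V" "inj_on q V"
    and A: "\<And>u v. u \<in> V \<Longrightarrow> v \<in> V \<Longrightarrow> u \<noteq> v \<Longrightarrow> A u v \<longleftrightarrow> (p u < p v) \<noteq> (q u < q v)"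
    and irr: "\<And>u. \<not> A u u"
    and a: "a \<in> V" "\<And>x. x \<in> V \<Longrightarrow> p a \<le> p x"
    and L: "forced_less V A a x y"
  shows "p x < p y"
  using L
proof (induction)
  case (forced_start x)
  then show ?case using a inj_onD[OF inj(1), of a x] by (metis order_le_less)
next
  case (forced_trans x y z)
  then show ?case by simp
next
  case (forced_right x y z)
  have V: "x \<in> V" "y \<in> V" "z \<in> V" "x \<noteq> y"
    using forced_less_in[OF forced_right(1) a(1)] forced_right by auto
  have sym: "A x y = A y x" using A[of x y] A[of y x] V inj_onD[OF inj(1), of x y] inj_onD[OF inj(2), of x y]
    by force
  show ?case
  proof (cases "z = x \<or> z = y")
    case True then show ?thesis using forced_right sym irr by auto
  next
    case False
    have "p z \<noteq> p x" "p z \<noteq> p y" "q z \<noteq> q x" "q z \<noteq> q y" "q x \<noteq> q y"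
      using False V inj unfolding inj_on_def by blast+
    then show ?thesis using A[of x y] A[of x z] A[of y z] False V forced_right(3,4,5)
      by (smt (verit))
  qed
next
  case (forced_left x y z)
  have V: "x \<in> V" "y \<in> V" "z \<in> V" "x \<noteq> y"
    using forced_less_in[OF forced_left(1) a(1)] forced_left by auto
  have sym: "A x y = A y x" using A[of x y] A[of y x] V inj_onD[OF inj(1), of x y] inj_onD[OF inj(2), of x y]
    by force
  show ?case
  proof (cases "z = x \<or> z = y")
    case True then show ?thesis using forced_left sym irr by auto
  next
    case False
    have "p z \<noteq> p x" "p z \<noteq> p y" "q z \<noteq> q x" "q z \<noteq> q y" "q x \<noteq> q y"
      using False V inj unfolding inj_on_def by blast+
    then show ?thesis using A[of x y] A[of z y] A[of x z] False V forced_left(3,4,5)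
      by (smt (verit))
  qed
qed

text \<open>The equivalence includes i = j and so demands irreflexivity. A starting vertex whose
  closure has a cycle has no listing and contributes no word.\<close>

definition forced_listing :: "'a set \<Rightarrow> ('a \<Rightarrow> 'a \<Rightarrow> bool) \<Rightarrow> 'a \<Rightarrow> 'a list \<Rightarrow> bool" where
  "forced_listing V A a xs \<longleftrightarrow> distinct xs \<and> set xs = V \<and>
     (\<forall>i < length xs. \<forall>j < length xs. forced_less V A a (xs ! i) (xs ! j) \<longleftrightarrow> i < j)"

lemma forced_listing_length: "forced_listing V A a xs \<Longrightarrow> length xs = card V"
  unfolding forced_listing_def using distinct_card by fastforce

lemma forced_listing_rank:
  assumes "forced_listing V A a xs" "i < length xs"
  shows "card {y \<in> V. forced_less V A a y (xs ! i)} = i"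
proof -
  have "{y \<in> V. forced_less V A a y (xs ! i)} = (!) xs ` {..<i}"
  proof (intro equalityI subsetI)
    fix y assume "y \<in> {y \<in> V. forced_less V A a y (xs ! i)}"
    then obtain j where "j < length xs" "y = xs ! j" "forced_less V A a (xs ! j) (xs ! i)"
      using assms(1) unfolding forced_listing_def by (metis (mono_tags) in_set_conv_nth mem_Collect_eq)
    then show "y \<in> (!) xs ` {..<i}" using assms unfolding forced_listing_def by blast
  next
    fix y assume "y \<in> (!) xs ` {..<i}"
    then obtain j where j: "j < i" "y = xs ! j" by blast
    then have "xs ! j \<in> V" using assms unfolding forced_listing_def by auto
    then show "y \<in> {y \<in> V. forced_less V A a y (xs ! i)}"
      using assms j less_trans[OF j(1) assms(2)] unfolding forced_listing_def by blast
  qed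
  moreover have "inj_on ((!) xs) {..<i}"
    using assms unfolding forced_listing_def by (auto simp: inj_on_def nth_eq_iff_index_eq)
  ultimately show ?thesis by (simp add: card_image)
qed

text \<open>The position of a vertex is its number of predecessors. Thus each starting vertex yields
  at most one word, and a search with one candidate per vertex is exhaustive.\<close>

lemma forced_listing_unique:
  assumes "forced_listing V A a xs" "forced_listing V A a ys"
  shows "xs = ys"
proof (rule nth_equalityI)
  show len: "length xs = length ys" using assms forced_listing_length by metis
  fix i assume i: "i < length xs"
  then have "xs ! i \<in> set ys" using assms unfolding forced_listing_def by auto
  then obtain j where j: "j < length ys" "ys ! j = xs ! i" by (auto simp: in_set_conv_nth)
  then have "j = i" using forced_listing_rank[OF assms(1) i] forced_listing_rank[OF assms(2) j(1)] by simp
  then show "xs ! i = ys ! i" using j by simp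
qed

lemma sorting_list_exists:
  fixes p :: "'a \<Rightarrow> int"
  assumes "finite V" "inj_on p V"
  obtains xs where "distinct xs" "set xs = V"
    "\<And>i j. i < length xs \<Longrightarrow> j < length xs \<Longrightarrow> p (xs ! i) < p (xs ! j) \<longleftrightarrow> i < j"
proof
  let ?s = "sorted_list_of_set (p ` V)"
  let ?xs = "map (inv_into V p) ?s"
  have s: "set ?s = p ` V" using assms by simp
  show "distinct ?xs" using s by (auto simp: distinct_map intro: inj_on_inv_into)
  show "set ?xs = V" using assms s by (auto simp: image_image)
  fix i j assume ij: "i < length ?xs" "j < length ?xs"
  have "p (?xs ! k) = ?s ! k" if "k < length ?xs" for k
  proof -
    have "?s ! k \<in> p ` V" using that s by (metis length_map nth_mem)
    then show ?thesis using that by (simp add: f_inv_into_f)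
  qed
  moreover have "?s ! i < ?s ! j \<longleftrightarrow> i < j"
    using ij strict_sorted_list_of_set[of "p ` V"]
    by (metis length_map linorder_neqE_nat order_less_asym sorted_wrt_nth_less)
  ultimately show "p (?xs ! i) < p (?xs ! j) \<longleftrightarrow> i < j" using ij by simp
qed

section \<open>Forced orders under isomorphism\<close>

lemma forced_less_iso:
  assumes f: "bij_betw f V V'" and A: "\<And>u v. u \<in> V \<Longrightarrow> v \<in> V \<Longrightarrow> A u v \<longleftrightarrow> A' (f u) (f v)"
    and a: "a \<in> V" and L: "forced_less V A a x y"
  shows "forced_less V' A' (f a) (f x) (f y)"
proof -
  have fV: "f u \<in> V'" if "u \<in> V" for u using f that by (auto simp: bij_betw_def)
  show ?thesis using L
  proof (induction)
    case (forced_start x)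
    then show ?case using a f fV by (auto intro!: forced_less.forced_start simp: bij_betw_def dest: inj_onD)
  next
    case (forced_trans x y z) then show ?case by (blast intro: forced_less.forced_trans)
  next
    case (forced_right x y z)
    have V: "x \<in> V" "y \<in> V" using forced_less_in[OF forced_right(1) a] by auto
    show ?case using forced_less.forced_right[OF forced_right.IH, of "f z"] forced_right.hyps A V fV by simp
  next
    case (forced_left x y z)
    have V: "x \<in> V" "y \<in> V" using forced_less_in[OF forced_left(1) a] by auto
    show ?case using forced_less.forced_left[OF forced_left.IH, of "f z"] forced_left.hyps A V fV by simp
  qed
qed

lemma forced_less_iso_iff:
  assumes f: "bij_betw f V V'" and A: "\<And>u v. u \<in> V \<Longrightarrow> v \<in> V \<Longrightarrow> A u v \<longleftrightarrow> A' (f u) (f v)"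
    and V: "a \<in> V" "x \<in> V" "y \<in> V"
  shows "forced_less V' A' (f a) (f x) (f y) \<longleftrightarrow> forced_less V A a x y"
proof
  let ?g = "inv_into V f"
  have g: "bij_betw ?g V' V" using f by (rule bij_betw_inv_into)
  have gf: "?g (f u) = u" if "u \<in> V" for u using f that by (rule bij_betw_inv_into_left)
  have fg: "f (?g u) = u" "?g u \<in> V" if "u \<in> V'" for u
    using f that bij_betw_inv_into_right[of f V V' u] g by (auto simp: bij_betw_def)
  have A': "A' u v \<longleftrightarrow> A (?g u) (?g v)" if "u \<in> V'" "v \<in> V'" for u v
    using that fg A by simp
  assume "forced_less V' A' (f a) (f x) (f y)"
  from forced_less_iso[where A = A' and A' = A, OF g A' _ this] show "forced_less V A a x y"
    using V gf f by (auto simp: bij_betw_def)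
qed (rule forced_less_iso[where A = A and A' = A', OF f A V(1)])

text \<open>In contrast to \<open>encode_graph\<close>, vertex numbers are left out: the word must
  not change when the vertices are renamed.\<close>

definition listing_word :: "('a \<Rightarrow> 'a \<Rightarrow> bool) \<Rightarrow> ('a \<Rightarrow> nat) \<Rightarrow> 'a list \<Rightarrow> bool list" where
  "listing_word A c xs =
     concat (map (\<lambda>x. encode_nat (c x)) xs) @ concat (map (\<lambda>x. map (A x) xs) xs)"

definition listing_words :: "'a set \<Rightarrow> ('a \<Rightarrow> 'a \<Rightarrow> bool) \<Rightarrow> ('a \<Rightarrow> nat) \<Rightarrow> bool list set" where
  "listing_words V A c = {listing_word A c xs | xs a. a \<in> V \<and> forced_listing V A a xs}"

text \<open>Bijective base 2, hence injective also on words of different lengths.\<close>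

definition word_value :: "bool list \<Rightarrow> nat" where
  "word_value w = foldl (\<lambda>v b. 2 * v + bit_cell b) 0 w"

text \<open>Words are compared by value because a program can hold the value in one cell and compare
  two of them by a single subtraction. The choice is unique since values are injective. The default
  \<open>[]\<close> serves the empty graph, which has no starting vertex.\<close>

definition max_word :: "bool list set \<Rightarrow> bool list" where
  "max_word W = (if W = {} then []
     else SOME w. w \<in> W \<and> (\<forall>w' \<in> W. word_value w' \<le> word_value w))"

text \<open>The prefix fixes the length of the listing, without which a word could not be cut into
  color codes and matrix rows. It is also the beginning of \<open>encode_graph\<close>, so the
  program finds it already in place.\<close>

definition canonical_word :: "'a set \<Rightarrow> ('a \<Rightarrow> 'a \<Rightarrow> bool) \<Rightarrow> ('a \<Rightarrow> nat) \<Rightarrow> bool list" where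
  "canonical_word V A c = encode_nat (card V) @ max_word (listing_words V A c)"

section \<open>Words determine the data that they encode\<close>

lemma word_value_simps [simp]:
  "word_value [] = 0" "word_value (w @ [b]) = 2 * word_value w + bit_cell b"
  by (auto simp: word_value_def)

lemma word_value_eq_0_iff [simp]: "word_value w = 0 \<longleftrightarrow> w = []"
  by (cases w rule: rev_cases) (auto simp: bit_cell_def)

lemma word_value_inj: "word_value w = word_value w' \<Longrightarrow> w = w'"
proof (induction w arbitrary: w' rule: rev_induct)
  case Nil then show ?case by (metis word_value_eq_0_iff)
next
  case (snoc b w)
  then have "w' \<noteq> []" by (auto simp: bit_cell_def split: if_splits)
  then obtain w'' b' where w': "w' = w'' @ [b']" by (metis append_butlast_last_id)
  have "b = b' \<and> word_value w = word_value w''"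
    using snoc.prems unfolding w' by (auto simp: bit_cell_def split: if_splits; presburger)
  then show ?case using snoc.IH w' by simp
qed

lemma max_word_eq:
  assumes "w \<in> W" "\<And>w'. w' \<in> W \<Longrightarrow> word_value w' \<le> word_value w"
  shows "max_word W = w"
proof -
  have "(SOME w. w \<in> W \<and> (\<forall>w' \<in> W. word_value w' \<le> word_value w)) = w"
    using assms by (intro some_equality) (auto intro: word_value_inj antisym)
  then show ?thesis using assms by (auto simp: max_word_def)
qed

lemma max_word_in:
  assumes "finite W" "W \<noteq> {}"
  shows "max_word W \<in> W"
proof -
  have "Max (word_value ` W) \<in> word_value ` W" using assms by (intro Max_in) auto
  then obtain w where "w \<in> W" "word_value w = Max (word_value ` W)" by auto
  then show ?thesis using max_word_eq[of w W] assms by simp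
qed

lemma encode_nat_rec:
  "encode_nat n = (if n = 0 then [False] else True # odd n # encode_nat (n div 2))"
  by (subst encode_nat_def, subst binary_digits.simps) (simp add: encode_nat_def)

lemma encode_nat_append_inject:
  "encode_nat x @ u = encode_nat y @ v \<longleftrightarrow> x = y \<and> u = v"
proof (induction x arbitrary: y rule: less_induct)
  case (less x)
  show ?case
  proof (cases "x = 0 \<or> y = 0")
    case True then show ?thesis
      by (subst encode_nat_rec, subst (2) encode_nat_rec) auto
  next
    case False
    have "encode_nat x @ u = encode_nat y @ v \<longleftrightarrow>
        odd x = odd y \<and> encode_nat (x div 2) @ u = encode_nat (y div 2) @ v"
      using False by (subst encode_nat_rec, subst (2) encode_nat_rec) simp
    also have "\<dots> \<longleftrightarrow> odd x = odd y \<and> x div 2 = y div 2 \<and> u = v"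
      using less[of "x div 2"] False by simp
    also have "\<dots> \<longleftrightarrow> x = y \<and> u = v"
      by (metis (no_types) bit_eq_rec)
    finally show ?thesis .
  qed
qed

lemma concat_encode_nat_inject:
  "length xs = length ys \<Longrightarrow>
   concat (map encode_nat xs) @ u = concat (map encode_nat ys) @ v \<longleftrightarrow> xs = ys \<and> u = v"
  by (induction xs ys rule: list_induct2) (auto simp: encode_nat_append_inject)

lemma concat_same_length_inject:
  "list_all2 (\<lambda>x y. length x = length y) xs ys \<Longrightarrow> concat xs = concat ys \<Longrightarrow> xs = ys"
  by (induction rule: list_all2_induct) auto

text \<open>Color codes are self-delimiting, but nothing marks where the codes end or a row of the
  matrix begins. Equal lengths of the listings supply these boundaries.\<close>

lemma listing_word_eqD:
  assumes eq: "listing_word A c xs = listing_word A' c' ys" and len: "length xs = length ys"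
  shows "i < length xs \<Longrightarrow> c (xs ! i) = c' (ys ! i)"
    and "i < length xs \<Longrightarrow> j < length xs \<Longrightarrow> A (xs ! i) (xs ! j) = A' (ys ! i) (ys ! j)"
proof -
  have "map c xs = map c' ys" and m: "concat (map (\<lambda>x. map (A x) xs) xs) = concat (map (\<lambda>x. map (A' x) ys) ys)"
    using eq concat_encode_nat_inject[of "map c xs" "map c' ys"] len
    by (auto simp: listing_word_def comp_def)
  then show "i < length xs \<Longrightarrow> c (xs ! i) = c' (ys ! i)" using len by (metis nth_map)
  have "map (\<lambda>x. map (A x) xs) xs = map (\<lambda>x. map (A' x) ys) ys"
    by (rule concat_same_length_inject[OF _ m]) (use len in \<open>auto simp: list_all2_conv_all_nth\<close>)
  then show "i < length xs \<Longrightarrow> j < length xs \<Longrightarrow> A (xs ! i) (xs ! j) = A' (ys ! i) (ys ! j)"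
    using len by (metis nth_map)
qed

section \<open>Canonical words characterize colored graphs up to isomorphism\<close>

lemma listing_word_cong:
  assumes "\<And>u v. u \<in> set xs \<Longrightarrow> v \<in> set xs \<Longrightarrow> A u v \<longleftrightarrow> A' (f u) (f v)"
    and "\<And>u. u \<in> set xs \<Longrightarrow> c u = c' (f u)"
  shows "listing_word A c xs = listing_word A' c' (map f xs)"
  using assms by (auto simp: listing_word_def intro!: arg_cong[where f = concat] arg_cong2[where f = "(@)"])

lemma listing_words_iso_subset:
  assumes f: "bij_betw f V V'" and A: "\<And>u v. u \<in> V \<Longrightarrow> v \<in> V \<Longrightarrow> A u v \<longleftrightarrow> A' (f u) (f v)"
    and c: "\<And>u. u \<in> V \<Longrightarrow> c u = c' (f u)"
  shows "listing_words V A c \<subseteq> listing_words V' A' c'"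
proof
  fix w assume "w \<in> listing_words V A c"
  then obtain a xs where w: "w = listing_word A c xs" "a \<in> V" "forced_listing V A a xs"
    by (auto simp: listing_words_def)
  have xs: "set xs = V" "distinct xs" using w by (auto simp: forced_listing_def)
  have "forced_listing V' A' (f a) (map f xs)"
    using w(3) f forced_less_iso_iff[where A = A and A' = A', OF f A w(2)] nth_mem[of _ xs]
    unfolding forced_listing_def by (auto simp: distinct_map bij_betw_def)
  moreover have "w = listing_word A' c' (map f xs)"
    unfolding w(1) by (rule listing_word_cong) (use xs A c in auto)
  ultimately show "w \<in> listing_words V' A' c'"
    using w(2) f by (auto simp: listing_words_def bij_betw_def)
qed

lemma canonical_word_iso:
  assumes f: "bij_betw f V V'" and A: "\<And>u v. u \<in> V \<Longrightarrow> v \<in> V \<Longrightarrow> A u v \<longleftrightarrow> A' (f u) (f v)"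
    and c: "\<And>u. u \<in> V \<Longrightarrow> c u = c' (f u)"
  shows "canonical_word V A c = canonical_word V' A' c'"
proof -
  let ?g = "inv_into V f"
  have g: "bij_betw ?g V' V" using f by (rule bij_betw_inv_into)
  have fg: "f (?g u) = u" "?g u \<in> V" if "u \<in> V'" for u
    using f that bij_betw_inv_into_right[of f V V' u] g by (auto simp: bij_betw_def)
  have "listing_words V A c \<subseteq> listing_words V' A' c'" by (rule listing_words_iso_subset) (fact f A c)+
  moreover have "listing_words V' A' c' \<subseteq> listing_words V A c"
    by (rule listing_words_iso_subset[OF g]) (simp_all add: A c fg)
  moreover have "card V = card V'" using f by (rule bij_betw_same_card)
  ultimately show ?thesis by (simp add: canonical_word_def)
qed

lemma finite_listing_words:
  assumes "finite V" shows "finite (listing_words V A c)"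
proof -
  have "listing_words V A c \<subseteq> listing_word A c ` {xs. set xs \<subseteq> V \<and> length xs = card V}"
  proof
    fix w assume "w \<in> listing_words V A c"
    then obtain a xs where w: "w = listing_word A c xs" and xs: "forced_listing V A a xs"
      by (auto simp: listing_words_def)
    have "length xs = card V" by (rule forced_listing_length[OF xs])
    moreover have "set xs \<subseteq> V" using xs unfolding forced_listing_def by blast
    ultimately show "w \<in> listing_word A c ` {xs. set xs \<subseteq> V \<and> length xs = card V}"
      unfolding w by blast
  qed
  then show ?thesis using finite_lists_length_eq[OF assms] finite_subset by blast
qed

text \<open>Each largest word comes from some listing, and equal words record the same colors and
  adjacencies at the same positions. Matching the two listings position by position is therefore an
  isomorphism, whichever starting vertices they came from. The nonemptiness hypotheses exclude that
  both words are merely the default.\<close>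

lemma canonical_word_eqD:
  assumes fin: "finite V" "finite V'"
    and ne: "V \<noteq> {} \<Longrightarrow> listing_words V A c \<noteq> {}" "V' \<noteq> {} \<Longrightarrow> listing_words V' A' c' \<noteq> {}"
    and eq: "canonical_word V A c = canonical_word V' A' c'"
  obtains f where "bij_betw f V V'" "\<And>u v. u \<in> V \<Longrightarrow> v \<in> V \<Longrightarrow> A u v \<longleftrightarrow> A' (f u) (f v)"
    "\<And>u. u \<in> V \<Longrightarrow> c u = c' (f u)"
proof (cases "V = {}")
  case True
  then have "V' = {}" using eq fin by (simp add: canonical_word_def encode_nat_append_inject)
  \<comment> \<open>On an empty vertex set any function is an isomorphism.\<close>
  then show ?thesis using True that[of undefined] by (simp add: bij_betw_def)
next
  case False
  have card: "card V = card V'" and mw: "max_word (listing_words V A c) = max_word (listing_words V' A' c')"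
    using eq by (auto simp: canonical_word_def encode_nat_append_inject)
  then have "V' \<noteq> {}" using False fin by auto
  obtain a xs where xs: "max_word (listing_words V A c) = listing_word A c xs" "forced_listing V A a xs"
    using max_word_in[OF finite_listing_words[OF fin(1)] ne(1)[OF False]] by (auto simp: listing_words_def)
  obtain b ys where ys: "max_word (listing_words V' A' c') = listing_word A' c' ys" "forced_listing V' A' b ys"
    using max_word_in[OF finite_listing_words[OF fin(2)] ne(2)[OF \<open>V' \<noteq> {}\<close>]] by (auto simp: listing_words_def)
  have len: "length xs = length ys" using xs ys card forced_listing_length by metis
  have dx: "distinct xs" "set xs = V" and dy: "distinct ys" "set ys = V'"
    using xs ys by (auto simp: forced_listing_def)
  note D = listing_word_eqD[OF _ len, of A c A' c']
  have bx: "bij_betw ((!) xs) {..<length xs} V" using dx by (auto intro: bij_betw_nth)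
  have by': "bij_betw ((!) ys) {..<length xs} V'" using dy len by (auto intro: bij_betw_nth)
  define h where "h = the_inv_into {..<length xs} ((!) xs)"
  have h: "bij_betw h V {..<length xs}" unfolding h_def by (rule bij_betw_the_inv_into[OF bx])
  have xh: "xs ! (h u) = u" "h u < length xs" if "u \<in> V" for u
    using that bx h by (auto simp: h_def bij_betw_def f_the_inv_into_f)
  show ?thesis
  proof (rule that[of "(!) ys \<circ> h"])
    show "bij_betw ((!) ys \<circ> h) V V'" using h by' by (rule bij_betw_trans)
    show "A u v \<longleftrightarrow> A' (((!) ys \<circ> h) u) (((!) ys \<circ> h) v)" if "u \<in> V" "v \<in> V" for u v
      using D(2)[of "h u" "h v"] xs ys mw xh that by simp
    show "c u = c' (((!) ys \<circ> h) u)" if "u \<in> V" for u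
      using D(1)[of "h u"] xs ys mw xh that by simp
  qed
qed

section \<open>Total correctness of programs with time bounds\<close>

text \<open>T is only an upper bound, so branches of different cost and loops of different length
  can share one bound that depends on the input length alone.\<close>

definition runs :: "prog \<Rightarrow> memory \<Rightarrow> nat \<Rightarrow> (memory \<Rightarrow> bool) \<Rightarrow> bool" where
  "runs p m T Q \<longleftrightarrow> (\<exists>t m'. exec p m t m' \<and> t \<le> T \<and> Q m')"

primrec writes :: "prog \<Rightarrow> nat set" where
  "writes Skip = {}"
| "writes (Write a i e) = {a}"
| "writes (Seq p q) = writes p \<union> writes q"
| "writes (If e p q) = writes p \<union> writes q"
| "writes (While e p) = writes p"

inductive_cases exec_SkipE: "exec Skip m t m'"
inductive_cases exec_WriteE: "exec (Write a i e) m t m'"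
inductive_cases exec_SeqE: "exec (Seq p q) m t m'"
inductive_cases exec_IfE: "exec (If e p q) m t m'"

lemma exec_writes: "exec p m t m' \<Longrightarrow> a \<notin> writes p \<Longrightarrow> m' a = m a"
  by (induction rule: exec.induct) auto

lemma runs_mono: "runs p m T Q \<Longrightarrow> T \<le> T' \<Longrightarrow> (\<And>m'. Q m' \<Longrightarrow> Q' m') \<Longrightarrow> runs p m T' Q'"
  unfolding runs_def by (meson order_trans)

lemma runs_frame:
  assumes "runs p m T Q" "\<And>m'. Q m' \<Longrightarrow> (\<And>a. a \<notin> writes p \<Longrightarrow> m' a = m a) \<Longrightarrow> Q' m'" "T \<le> T'"
  shows "runs p m T' Q'"
  using assms exec_writes unfolding runs_def by (meson order_trans)

lemma runs_Skip [simp]: "runs Skip m T Q \<longleftrightarrow> 1 \<le> T \<and> Q m"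
proof
  show "runs Skip m T Q \<Longrightarrow> 1 \<le> T \<and> Q m" unfolding runs_def by (auto elim!: exec_SkipE)
  show "1 \<le> T \<and> Q m \<Longrightarrow> runs Skip m T Q" unfolding runs_def using exec_Skip by blast
qed

lemma runs_Write [simp]:
  "runs (Write a i e) m T Q \<longleftrightarrow> 1 \<le> T \<and> Q (m(a := (m a)(eval_expr i m := eval_expr e m)))"
  (is "_ \<longleftrightarrow> _ \<and> Q ?m")
proof
  show "runs (Write a i e) m T Q \<Longrightarrow> 1 \<le> T \<and> Q ?m" unfolding runs_def by (auto elim!: exec_WriteE)
  show "1 \<le> T \<and> Q ?m \<Longrightarrow> runs (Write a i e) m T Q" unfolding runs_def using exec_Write by blast
qed

lemma runs_If [simp]:
  "runs (If e p q) m T Q \<longleftrightarrow>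
     1 \<le> T \<and> (if eval_expr e m \<noteq> 0 then runs p m (T - 1) Q else runs q m (T - 1) Q)"
proof
  assume "runs (If e p q) m T Q"
  then obtain t m' where "exec (If e p q) m t m'" "t \<le> T" "Q m'" unfolding runs_def by blast
  then show "1 \<le> T \<and> (if eval_expr e m \<noteq> 0 then runs p m (T - 1) Q else runs q m (T - 1) Q)"
    unfolding runs_def by (elim exec_IfE) (auto intro!: exI)
next
  assume *: "1 \<le> T \<and> (if eval_expr e m \<noteq> 0 then runs p m (T - 1) Q else runs q m (T - 1) Q)"
  then obtain t m' where t: "exec (if eval_expr e m \<noteq> 0 then p else q) m t m'" "t \<le> T - 1" "Q m'"
    unfolding runs_def by (cases "eval_expr e m = 0") auto
  then have "exec (If e p q) m (t + 1) m'" by (auto intro: exec.intros split: if_splits simp del: add_Suc_right One_nat_def)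
  moreover have "t + 1 \<le> T" using t * by linarith
  ultimately show "runs (If e p q) m T Q" using t unfolding runs_def by blast
qed

lemma runs_Seq_iff: "runs (Seq p q) m T Q \<longleftrightarrow> (\<exists>T1 \<le> T. runs p m T1 (\<lambda>m'. runs q m' (T - T1) Q))"
proof
  assume "runs (Seq p q) m T Q"
  then obtain t m' where "exec (Seq p q) m t m'" "t \<le> T" "Q m'" unfolding runs_def by blast
  then obtain t1 m1 t2 where "exec p m t1 m1" "exec q m1 t2 m'" "t = t1 + t2" by (elim exec_SeqE) auto
  then show "\<exists>T1 \<le> T. runs p m T1 (\<lambda>m'. runs q m' (T - T1) Q)"
    using \<open>t \<le> T\<close> \<open>Q m'\<close> unfolding runs_def by (intro exI[of _ t1]) (auto intro!: exI)
next
  assume "\<exists>T1 \<le> T. runs p m T1 (\<lambda>m'. runs q m' (T - T1) Q)"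
  then obtain T1 t1 m1 t2 m2 where "T1 \<le> T" "exec p m t1 m1" "t1 \<le> T1" "exec q m1 t2 m2" "t2 \<le> T - T1" "Q m2"
    unfolding runs_def by blast
  then show "runs (Seq p q) m T Q" unfolding runs_def
    by (intro exI[of _ "t1 + t2"] exI[of _ m2]) (auto intro: exec_Seq)
qed

lemma runs_Seq: "runs p m T1 (\<lambda>m'. runs q m' T2 Q) \<Longrightarrow> runs (Seq p q) m (T1 + T2) Q"
  unfolding runs_Seq_iff by (rule exI[of _ T1]) simp

lemma runs_Seq_Skip [simp]: "runs (Seq Skip q) m T Q \<longleftrightarrow> 1 \<le> T \<and> runs q m (T - 1) Q"
  unfolding runs_Seq_iff by (auto elim: runs_mono intro!: exI[of _ "1::nat"])

lemma runs_Seq_Write [simp]: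
  "runs (Seq (Write a i e) q) m T Q \<longleftrightarrow>
     1 \<le> T \<and> runs q (m(a := (m a)(eval_expr i m := eval_expr e m))) (T - 1) Q"
  unfolding runs_Seq_iff by (auto elim: runs_mono intro!: exI[of _ "1::nat"])

text \<open>The continuation moves into both branches. Together with the rules for
  \<open>Write\<close> and \<open>Skip\<close> this lets the simplifier execute loop-free code
  symbolically; only loops and subprograms need \<open>runs_Seq\<close>.\<close>

lemma runs_Seq_If [simp]:
  "runs (Seq (If e p q) r) m T Q \<longleftrightarrow>
     1 \<le> T \<and> (if eval_expr e m \<noteq> 0 then runs (Seq p r) m (T - 1) Q else runs (Seq q r) m (T - 1) Q)"
proof -
  have "(\<exists>T1 \<le> T. 1 \<le> T1 \<and> runs p' m (T1 - 1) (\<lambda>m'. runs r m' (T - T1) Q)) \<longleftrightarrow>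
    1 \<le> T \<and> (\<exists>T1 \<le> T - 1. runs p' m T1 (\<lambda>m'. runs r m' (T - 1 - T1) Q))" for p'
  proof safe
    fix T1 assume "T1 \<le> T" "1 \<le> T1" "runs p' m (T1 - 1) (\<lambda>m'. runs r m' (T - T1) Q)"
    then show "\<exists>T1 \<le> T - 1. runs p' m T1 (\<lambda>m'. runs r m' (T - 1 - T1) Q)"
      by (intro exI[of _ "T1 - 1"]) auto
  next
    fix T1 assume "1 \<le> T" "T1 \<le> T - 1" "runs p' m T1 (\<lambda>m'. runs r m' (T - 1 - T1) Q)"
    then show "\<exists>T1 \<le> T. 1 \<le> T1 \<and> runs p' m (T1 - 1) (\<lambda>m'. runs r m' (T - T1) Q)"
      by (intro exI[of _ "Suc T1"]) auto
  qed auto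
  from this[of p] this[of q] show ?thesis unfolding runs_Seq_iff runs_If by auto
qed

lemma runs_While_false: "eval_expr e m = 0 \<Longrightarrow> 1 \<le> T \<Longrightarrow> Q m \<Longrightarrow> runs (While e p) m T Q"
  unfolding runs_def using exec_While_false by blast

lemma runs_While_true:
  assumes "eval_expr e m \<noteq> 0" "runs p m T1 (\<lambda>m'. runs (While e p) m' T2 Q)" "T1 + T2 + 1 \<le> T"
  shows "runs (While e p) m T Q"
proof -
  from assms(2) obtain t1 m1 t2 m2 where "exec p m t1 m1" "t1 \<le> T1" "exec (While e p) m1 t2 m2" "t2 \<le> T2" "Q m2"
    unfolding runs_def by blast
  then show ?thesis
    using assms(1,3) unfolding runs_def
    by (intro exI[of _ "t1 + t2 + 1"] exI[of _ m2]) (auto intro: exec_While_true[simplified])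
qed

section \<open>Counting loops\<close>

abbreviation Var :: "nat \<Rightarrow> expr" where "Var a \<equiv> Read a (Const 0)"

abbreviation Set :: "nat \<Rightarrow> expr \<Rightarrow> prog" where "Set a e \<equiv> Write a (Const 0) e"

definition For :: "nat \<Rightarrow> nat \<Rightarrow> prog \<Rightarrow> prog" where
  "For v b p = Seq (Set v (Const 0))
     (While (Minus (Var b) (Var v)) (Seq p (Set v (Plus (Var v) (Const 1)))))"

lemma writes_For [simp]: "writes (For v b p) = insert v (writes p)"
  by (auto simp: For_def)

text \<open>At most l rounds, each consisting of the body, a test and the increment; the final 2
  pays for the initialization and the failing test.\<close>

definition loop_time :: "nat \<Rightarrow> nat \<Rightarrow> nat" where
  "loop_time l T = l * (T + 2) + 2"

text \<open>The invariant speaks of the memory in which the counter already has its new value, hence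
  the explicit updates of \<open>v\<close> in \<open>init\<close> and \<open>step\<close>; so it
  need not be independent of the counter. Everything outside the written arrays is handed to
  \<open>step\<close> and \<open>final\<close> as unchanged since the start, which keeps such facts
  out of the invariants.\<close>

lemma runs_For:
  assumes vb: "v \<notin> writes p" "b \<notin> writes p" "b \<noteq> v" and N: "m b 0 = N" "N \<le> l"
    and init: "I 0 (m(v := (m v)(0 := 0)))"
    and step: "\<And>k m'. \<lbrakk>k < N; I k m'; m' v 0 = k;
        \<And>a. a \<noteq> v \<Longrightarrow> a \<notin> writes p \<Longrightarrow> m' a = m a\<rbrakk> \<Longrightarrow>
      runs p m' T (\<lambda>m''. I (Suc k) (m''(v := (m'' v)(0 := Suc k))))"
    and final: "\<And>m'. \<lbrakk>I N m'; m' v 0 = N; \<And>a. a \<noteq> v \<Longrightarrow> a \<notin> writes p \<Longrightarrow> m' a = m a\<rbrakk> \<Longrightarrow> Q m'"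
    and T': "loop_time l T \<le> T'"
  shows "runs (For v b p) m T' Q"
proof -
  let ?e = "Minus (Var b) (Var v)" and ?p = "Seq p (Set v (Plus (Var v) (Const 1)))"
  \<comment> \<open>Induction on the number i of rounds still to come, as the time that remains
    depends on it.\<close>
  have loop: "runs (While ?e ?p) m' (i * (T + 2) + 1) Q"
    if "i \<le> N" "I (N - i) m'" "m' v 0 = N - i" "\<And>a. a \<noteq> v \<Longrightarrow> a \<notin> writes p \<Longrightarrow> m' a = m a" for i m'
    using that
  proof (induction i arbitrary: m')
    case 0
    then show ?case using N vb by (intro runs_While_false final) auto
  next
    case (Suc i)
    have k: "N - Suc i < N" "Suc (N - Suc i) = N - i" using Suc.prems(1) by auto
    have "runs p m' T (\<lambda>m''. I (N - i) (m''(v := (m'' v)(0 := N - i))))"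
      using step[OF k(1) Suc.prems(2,3)] Suc.prems(4) k(2) by simp
    then have "runs p m' T (\<lambda>m''. runs (Set v (Plus (Var v) (Const 1))) m'' 1
        (\<lambda>m'. runs (While ?e ?p) m' (i * (T + 2) + 1) Q))"
    proof (rule runs_frame)
      fix m'' assume I: "I (N - i) (m''(v := (m'' v)(0 := N - i)))"
        and fr: "\<And>a. a \<notin> writes p \<Longrightarrow> m'' a = m' a"
      have "m'' v 0 + 1 = N - i" using fr[OF vb(1)] Suc.prems(3) k(2) by simp
      moreover have "runs (While ?e ?p) (m''(v := (m'' v)(0 := N - i))) (i * (T + 2) + 1) Q"
      proof (rule Suc.IH[OF _ I])
        show "(m''(v := (m'' v)(0 := N - i))) a = m a" if "a \<noteq> v" "a \<notin> writes p" for a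
          using fr[OF that(2)] Suc.prems(4)[OF that] that(1) by simp
      qed (use Suc.prems(1) in simp_all)
      ultimately show "runs (Set v (Plus (Var v) (Const 1))) m'' 1 (\<lambda>m'. runs (While ?e ?p) m' (i * (T + 2) + 1) Q)"
        by simp
    qed simp
    then have "runs ?p m' (T + 1) (\<lambda>m'. runs (While ?e ?p) m' (i * (T + 2) + 1) Q)"
      by (rule runs_Seq)
    moreover have "eval_expr ?e m' \<noteq> 0" using Suc.prems N vb by simp
    ultimately show ?case by (intro runs_While_true) auto
  qed
  have "N * (T + 2) + 2 \<le> T'" using T' mult_le_mono1[OF N(2), of "T + 2"] by (simp add: loop_time_def)
  moreover have "runs (While ?e ?p) (m(v := (m v)(0 := 0))) (N * (T + 2) + 1) Q"
    using loop[of N] init by simp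
  ultimately show ?thesis unfolding For_def by (auto elim: runs_mono)
qed

text \<open>
  A scalar is cell \<open>0\<close> of an array of its own, so that the set of arrays written by a program tells
  which variables it preserves. Proper arrays are the input, \<open>CS\<close> and \<open>CL\<close> (start and length of the
  code of each color), \<open>OFF\<close> (row offsets, for the input and \<open>REL\<close>), \<open>REL\<close>, \<open>PERM\<close> and \<open>CAND\<close>.
\<close>

abbreviation (input) "INP \<equiv> 0 :: nat"
abbreviation (input) "POS \<equiv> 28 :: nat"
abbreviation (input) "ACC \<equiv> 2 :: nat"
abbreviation (input) "POW \<equiv> 3 :: nat"
abbreviation (input) "NV \<equiv> 4 :: nat"
abbreviation (input) "HDR \<equiv> 5 :: nat"
abbreviation (input) "VI \<equiv> 6 :: nat"
abbreviation (input) "VJ \<equiv> 7 :: nat"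
abbreviation (input) "VK \<equiv> 8 :: nat"
abbreviation (input) "VR \<equiv> 9 :: nat"
abbreviation (input) "VS \<equiv> 10 :: nat"
abbreviation (input) "VA \<equiv> 11 :: nat"
abbreviation (input) "CS \<equiv> 12 :: nat"
abbreviation (input) "CL \<equiv> 13 :: nat"
abbreviation (input) "OFF \<equiv> 14 :: nat"
abbreviation (input) "REL \<equiv> 15 :: nat"
abbreviation (input) "RANK \<equiv> 16 :: nat"
abbreviation (input) "PERM \<equiv> 17 :: nat"
abbreviation (input) "CAND \<equiv> 18 :: nat"
abbreviation (input) "OUTP \<equiv> 19 :: nat"
abbreviation (input) "START \<equiv> 20 :: nat"
abbreviation (input) "VAL \<equiv> 21 :: nat"
abbreviation (input) "BEST \<equiv> 22 :: nat"
abbreviation (input) "BS \<equiv> 23 :: nat"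
abbreviation (input) "BL \<equiv> 24 :: nat"
abbreviation (input) "GOOD \<equiv> 25 :: nat"
abbreviation (input) "VX \<equiv> 26 :: nat"
abbreviation (input) "VB \<equiv> 27 :: nat"

section \<open>Decoding a self-delimiting number\<close>

definition decode_loop :: prog where
  "decode_loop = While (Minus (Read INP (Var POS)) (Const 1))
     (Seq (If (Minus (Read INP (Plus (Var POS) (Const 1))) (Const 1)) (Set ACC (Plus (Var ACC) (Var POW))) Skip)
     (Seq (Set POW (Plus (Var POW) (Var POW)))
          (Set POS (Plus (Var POS) (Const 2)))))"

definition decode :: prog where
  "decode = Seq (Set ACC (Const 0)) (Seq (Set POW (Const 1))
     (Seq decode_loop (Set POS (Plus (Var POS) (Const 1)))))"

lemma writes_decode [simp]: "writes decode = {ACC, POW, POS}"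
  by (auto simp: decode_def decode_loop_def)

text \<open>Bits are stored as 1 and 2, so subtracting 1 tests a bit. Arbitrary contents of
  \<open>ACC\<close> and \<open>POW\<close> let the induction pass to \<open>x div 2\<close> with
  \<open>POW\<close> doubled. A digit takes two bits of code and five steps. The loop stops on the
  closing \<open>False\<close>, one cell before the end of the code, hence the
  \<open>+ 1\<close>.\<close>

lemma runs_decode_loop:
  assumes "\<And>i. i < length w \<Longrightarrow> m INP i = bit_cell (w ! i)" "w = u @ encode_nat x @ v" "m POS 0 = length u"
  shows "runs decode_loop m (5 * length (encode_nat x)) (\<lambda>m'.
    m' ACC 0 = m ACC 0 + m POW 0 * x \<and> m' POS 0 + 1 = length u + length (encode_nat x))"
  using assms
proof (induction x arbitrary: u m rule: less_induct)
  case (less x)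
  show ?case
  proof (cases "x = 0")
    case True
    have "m INP (length u) = 1"
      using less.prems(1)[of "length u"] less.prems(2) True by (simp add: encode_nat_rec bit_cell_def)
    then show ?thesis unfolding decode_loop_def
      using True less.prems by (intro runs_While_false) (auto simp: encode_nat_rec)
  next
    case False
    have code: "encode_nat x = True # odd x # encode_nat (x div 2)"
      using False by (subst encode_nat_rec) simp
    have bits: "m INP (length u) = 2" "m INP (Suc (length u)) = bit_cell (odd x)"
      using less.prems(1)[of "length u"] less.prems(1)[of "Suc (length u)"] less.prems(2) code
      by (auto simp: bit_cell_def nth_append)
    define m0 where "m0 = (if odd x then m(ACC := (m ACC)(0 := m ACC 0 + m POW 0)) else m)"
    define m1 where "m1 = m0(POW := (m POW)(0 := m POW 0 + m POW 0), POS := (m POS)(0 := m POS 0 + 2))"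
    have IH: "runs decode_loop m1 (5 * length (encode_nat (x div 2))) (\<lambda>m'.
      m' ACC 0 = m1 ACC 0 + m1 POW 0 * (x div 2) \<and>
      m' POS 0 + 1 = length (u @ [True, odd x]) + length (encode_nat (x div 2)))"
      by (rule less.IH) (use False less.prems code in \<open>auto simp: m1_def m0_def\<close>)
    have x: "x = (if odd x then 1 else 0) + 2 * (x div 2)" by presburger
    have "m1 ACC 0 + m1 POW 0 * (x div 2) = m ACC 0 + m POW 0 * x"
      by (subst (2) x) (simp add: m1_def m0_def algebra_simps)
    then have IH': "runs decode_loop m1 (5 * length (encode_nat (x div 2))) (\<lambda>m'.
      m' ACC 0 = m ACC 0 + m POW 0 * x \<and> m' POS 0 + 1 = length u + length (encode_nat x))"
      using IH by (auto simp: code elim: runs_mono)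
    show ?thesis
      unfolding decode_loop_def
    proof (rule runs_While_true[where ?T1.0 = 4], unfold decode_loop_def[symmetric])
      show "runs (Seq (If (Minus (Read INP (Plus (Var POS) (Const 1))) (Const 1)) (Set ACC (Plus (Var ACC) (Var POW))) Skip)
         (Seq (Set POW (Plus (Var POW) (Var POW))) (Set POS (Plus (Var POS) (Const 2))))) m 4
        (\<lambda>m'. runs decode_loop m' (5 * length (encode_nat (x div 2)))
          (\<lambda>m'. m' ACC 0 = m ACC 0 + m POW 0 * x \<and> m' POS 0 + 1 = length u + length (encode_nat x)))"
        using IH' bits less.prems(3) by (cases "odd x") (simp_all add: m1_def m0_def bit_cell_def)
    qed (use bits less.prems code in auto)
  qed
qed

lemma runs_decode:
  assumes "\<And>i. i < length w \<Longrightarrow> m INP i = bit_cell (w ! i)" "w = u @ encode_nat x @ v" "m POS 0 = length u"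
    "length w \<le> l"
  shows "runs decode m (5 * l + 3) (\<lambda>m'. m' ACC 0 = x \<and> m' POS 0 = length u + length (encode_nat x))"
proof -
  let ?m = "m(ACC := (m ACC)(0 := 0), POW := (m POW)(0 := 1))"
  have "runs (Seq decode_loop (Set POS (Plus (Var POS) (Const 1)))) ?m (5 * length (encode_nat x) + 1)
     (\<lambda>m'. m' ACC 0 = x \<and> m' POS 0 = length u + length (encode_nat x))"
    by (rule runs_Seq, rule runs_mono[OF runs_decode_loop[of w ?m u x v]]) (use assms in auto)
  then show ?thesis using assms unfolding decode_def by (auto elim: runs_mono)
qed

section \<open>Computing the forced order\<close>

text \<open>All rules whose first premise is (i, j) and whose third vertex is k, decided from the
  same S. A program may still perform the two insertions one after the other, since the second
  condition looks only at A.\<close>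

definition forced_step :: "('a \<Rightarrow> 'a \<Rightarrow> bool) \<Rightarrow> 'a \<Rightarrow> 'a \<Rightarrow> 'a \<Rightarrow> 'a rel \<Rightarrow> 'a rel" where
  "forced_step A i j k S = (if (i, j) \<in> S then S \<union>
      (if (j, k) \<in> S \<or> A i j = A i k \<and> A i j \<noteq> A j k then {(i, k)} else {}) \<union>
      (if A i j = A k j \<and> A i j \<noteq> A i k then {(k, j)} else {})
    else S)"

text \<open>Later steps see the insertions of earlier ones, as they do when a single array is
  updated in place.\<close>

definition forced_round :: "nat \<Rightarrow> (nat \<Rightarrow> nat \<Rightarrow> bool) \<Rightarrow> nat rel \<Rightarrow> nat rel" where
  "forced_round n A = fold (\<lambda>i. fold (\<lambda>j. fold (forced_step A i j) [0..<n]) [0..<n]) [0..<n]"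

section \<open>The closure as a fixpoint of rounds\<close>

definition inflationary :: "('a set \<Rightarrow> 'a set) \<Rightarrow> bool" where
  "inflationary f \<longleftrightarrow> mono f \<and> (\<forall>S. S \<subseteq> f S)"

lemma inflationary_fold:
  "(\<And>x. x \<in> set xs \<Longrightarrow> inflationary (f x)) \<Longrightarrow> inflationary (fold f xs)"
proof (induction xs)
  case Nil
  show ?case by (simp add: inflationary_def mono_def)
next
  case (Cons x xs)
  then have "inflationary (f x)" "inflationary (fold f xs)" by simp_all
  then show ?case unfolding inflationary_def by (auto simp: mono_def) (meson subset_iff)+
qed

text \<open>When the turn of x comes, the set has only grown, so by monotonicity the step yields at
  least f x S; afterwards nothing is removed.\<close>

lemma fold_inflationary_member:
  assumes "\<And>x. inflationary (f x)" "x \<in> set xs"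
  shows "f x S \<subseteq> fold f xs S"
  using assms(2)
proof (induction xs arbitrary: S)
  case (Cons y xs)
  have "f x S \<subseteq> f x (f y S)" using assms(1) by (meson inflationary_def monoD)
  moreover have "f y S \<subseteq> fold f xs (f y S)"
    using inflationary_fold[of xs f] assms(1) by (auto simp: inflationary_def)
  ultimately show ?case using Cons by auto
qed simp

lemma inflationary_forced_step: "inflationary (forced_step A i j k)"
  by (auto simp: inflationary_def forced_step_def mono_def)

lemma inflationary_forced_round: "inflationary (forced_round n A)"
  unfolding forced_round_def by (intro inflationary_fold inflationary_forced_step)

lemma forced_step_subset_round:
  assumes "i < n" "j < n" "k < n"
  shows "forced_step A i j k S \<subseteq> forced_round n A S"
proof -
  let ?f = "\<lambda>i j. fold (forced_step A i j) [0..<n]"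
  have "forced_step A i j k S \<subseteq> ?f i j S"
    using assms by (intro fold_inflationary_member inflationary_forced_step) auto
  also have "\<dots> \<subseteq> fold (?f i) [0..<n] S"
    using assms by (intro fold_inflationary_member[where f = "?f i"] inflationary_fold inflationary_forced_step) auto
  also have "\<dots> \<subseteq> forced_round n A S"
    unfolding forced_round_def using assms
    by (intro fold_inflationary_member[where f = "\<lambda>i. fold (?f i) [0..<n]"] inflationary_fold inflationary_forced_step) auto
  finally show ?thesis .
qed

lemma fold_invariant_set:
  "\<lbrakk>P S; \<And>x S. x \<in> set xs \<Longrightarrow> P S \<Longrightarrow> P (f x S)\<rbrakk> \<Longrightarrow> P (fold f xs S)"
  by (induction xs arbitrary: S) auto

text \<open>As long as no fixpoint is reached, every application adds an element of U. After card U
  applications there is a fixpoint, or the set is U itself, which is one.\<close>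

lemma inflationary_funpow_fixpoint:
  assumes f: "inflationary f" and U: "finite U" "\<And>S. S \<subseteq> U \<Longrightarrow> f S \<subseteq> U" and S: "S \<subseteq> U"
  shows "f ((f ^^ card U) S) = (f ^^ card U) S"
proof -
  have sub: "(f ^^ k) S \<subseteq> U" for k using S U(2) by (induction k) auto
  have "f ((f ^^ k) S) = (f ^^ k) S \<or> k \<le> card ((f ^^ k) S)" for k
  proof (induction k)
    case (Suc k)
    show ?case
    proof (cases "f ((f ^^ k) S) = (f ^^ k) S")
      case False
      then have "(f ^^ k) S \<subset> (f ^^ Suc k) S" using f by (auto simp: inflationary_def)
      then have "card ((f ^^ k) S) < card ((f ^^ Suc k) S)"
        using sub[of "Suc k"] U(1) by (meson finite_subset psubset_card_mono)
      then show ?thesis using Suc False by linarith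
    qed simp
  qed simp
  from this[of "card U"] show ?thesis
  proof
    assume "card U \<le> card ((f ^^ card U) S)"
    then have "(f ^^ card U) S = U" using sub U(1) by (meson card_seteq)
    then show ?thesis using f U(2)[of U] by (auto simp: inflationary_def)
  qed
qed

text \<open>Every insertion is an instance of a rule, so the rounds stay inside the closure. There
  are \<open>n * n\<close> pairs, so after that many rounds the set is a fixpoint; a round contains
  each single step, so the fixpoint is closed under all rules.\<close>

lemma forced_round_closure:
  assumes a: "a < n"
  shows "(forced_round n A ^^ (n * n)) {(a, j) | j. j < n \<and> j \<noteq> a} =
    {(i, j). forced_less {..<n} A a i j}" (is "(?f ^^ _) ?S = ?L")
proof -
  have step_L: "forced_step A i j k S \<subseteq> ?L" if "S \<subseteq> ?L" "k < n" for S i j k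
    using that unfolding forced_step_def
    by (auto intro: forced_trans forced_right forced_left split: if_splits)
  have round_L: "?f S \<subseteq> ?L" if "S \<subseteq> ?L" for S
    unfolding forced_round_def using that
    by (intro fold_invariant_set[where P = "\<lambda>S. S \<subseteq> ?L"] step_L) auto
  have S_L: "?S \<subseteq> ?L" by (auto intro: forced_start)
  let ?U = "{..<n} \<times> {..<n}"
  have L_U: "?L \<subseteq> ?U" using forced_less_in[of "{..<n}" A a] a by auto
  have step_U: "forced_step A i j k S \<subseteq> ?U" if "S \<subseteq> ?U" "k < n" for S i j k
    using that unfolding forced_step_def by (auto split: if_splits)
  have round_U: "?f S \<subseteq> ?U" if "S \<subseteq> ?U" for S
    unfolding forced_round_def using that
    by (intro fold_invariant_set[where P = "\<lambda>S. S \<subseteq> ?U"] step_U) auto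
  define R where "R = (?f ^^ (n * n)) ?S"
  have "?f ((?f ^^ card ?U) ?S) = (?f ^^ card ?U) ?S"
    using S_L L_U by (intro inflationary_funpow_fixpoint inflationary_forced_round round_U) auto
  then have fixp: "?f R = R" by (simp add: R_def card_cartesian_product)
  have R_L: "(?f ^^ k) ?S \<subseteq> ?L" for k using S_L round_L by (induction k) auto
  have S_R: "?S \<subseteq> (?f ^^ k) ?S" for k
    using inflationary_forced_round[of n A] by (induction k) (auto simp: inflationary_def)
  have closed: "forced_step A i j k R \<subseteq> R" if "i < n" "j < n" "k < n" for i j k
    using forced_step_subset_round[OF that, of A R] fixp by simp
  have "(i, j) \<in> R" if "forced_less {..<n} A a i j" for i j
    using that
  proof (induction)
    case (forced_start x)
    then show ?case using S_R[of "n * n"] by (auto simp: R_def)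
  next
    case (forced_trans x y z)
    then show ?case
      using closed[of x y z] forced_less_in[OF forced_trans(1)] forced_less_in[OF forced_trans(2)] a
      by (auto simp: forced_step_def)
  next
    case (forced_right x y z)
    then show ?case
      using closed[of x y z] forced_less_in[OF forced_right(1)] a
      by (auto simp: forced_step_def split: if_splits)
  next
    case (forced_left x y z)
    then show ?case
      using closed[of x y z] forced_less_in[OF forced_left(1)] a
      by (auto simp: forced_step_def split: if_splits)
  qed
  then show ?thesis using R_L[of "n * n"] by (auto simp: R_def)
qed

text \<open>Total, transitive and irreflexive means strictly linear, so ranks increase strictly
  along the order and run through all of 0, ..., n - 1. The function g stands for an array into
  which each vertex has been written at its rank.\<close>

lemma forced_listing_ranks:
  assumes total: "\<And>x y. x < n \<Longrightarrow> y < n \<Longrightarrow> x \<noteq> y \<Longrightarrow> forced_less {..<n} A a x y \<or> forced_less {..<n} A a y x"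
    and a: "a < n"
    and irrefl: "\<And>x. x < n \<Longrightarrow> \<not> forced_less {..<n} A a x x"
    and rank: "\<And>x. rank x = card {y. y < n \<and> forced_less {..<n} A a y x}"
  shows "bij_betw rank {..<n} {..<n}"
    and "\<lbrakk>\<And>x. x < n \<Longrightarrow> g (rank x) = x\<rbrakk> \<Longrightarrow> forced_listing {..<n} A a (map g [0..<n])"
proof -
  let ?L = "forced_less {..<n} A a"
  have mono: "rank x < rank y" if "?L x y" for x y
  proof -
    have xy: "x < n" "y < n" using forced_less_in[OF that] a by auto
    have "{z. z < n \<and> ?L z x} \<subset> {z. z < n \<and> ?L z y}"
      using that irrefl xy forced_trans[of "{..<n}" A a] by blast
    then show ?thesis unfolding rank by (intro psubset_card_mono) auto
  qed
  have inj: "inj_on rank {..<n}"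
  proof (rule inj_onI)
    fix x y assume *: "x \<in> {..<n}" "y \<in> {..<n}" "rank x = rank y"
    show "x = y"
    proof (rule ccontr)
      assume "x \<noteq> y"
      then have "?L x y \<or> ?L y x" using total * by simp
      then show False using mono *(3) by fastforce
    qed
  qed
  have "rank x < n" if "x < n" for x
  proof -
    have "{y. y < n \<and> ?L y x} \<subset> {..<n}" using irrefl that by auto
    then have "card {y. y < n \<and> ?L y x} < card {..<n}" by (intro psubset_card_mono) auto
    then show ?thesis by (simp add: rank)
  qed
  then have im: "rank ` {..<n} = {..<n}"
    using inj by (intro endo_inj_surj) auto
  then show bij: "bij_betw rank {..<n} {..<n}" using inj by (simp add: bij_betw_def)
  assume g: "\<And>x. x < n \<Longrightarrow> g (rank x) = x"
  have rg: "rank (g i) = i \<and> g i < n" if i: "i < n" for i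
  proof -
    obtain x where "x < n" "rank x = i" using im i by (metis imageE lessThan_iff)
    then show ?thesis using g by auto
  qed
  have "?L (g i) (g j) \<longleftrightarrow> i < j" if "i < n" "j < n" for i j
  proof
    show "?L (g i) (g j) \<Longrightarrow> i < j" using mono[of "g i" "g j"] rg that by simp
    assume ij: "i < j"
    then have "g i \<noteq> g j" using rg that by (metis less_irrefl)
    then have "?L (g i) (g j) \<or> ?L (g j) (g i)" using total rg that by simp
    then show "?L (g i) (g j)" using mono[of "g j" "g i"] rg that ij by auto
  qed
  moreover have "distinct (map g [0..<n])"
    using rg by (auto simp: distinct_map inj_on_def) metis
  moreover have "set (map g [0..<n]) = {..<n}"
  proof (intro equalityI subsetI)
    fix x assume "x \<in> {..<n}"
    then have "g (rank x) = x" "rank x < n" using g im by auto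
    then show "x \<in> set (map g [0..<n])" by force
  qed (use rg in auto)
  ultimately show "forced_listing {..<n} A a (map g [0..<n])" by (simp add: forced_listing_def)
qed

section \<open>Programs for the closure and the ranks\<close>

definition eqE :: "expr \<Rightarrow> expr \<Rightarrow> expr" where
  "eqE e f = Minus (Const 1) (Plus (Minus e f) (Minus f e))"

lemma eval_eqE [simp]: "eval_expr (eqE e f) m = (if eval_expr e m = eval_expr f m then 1 else 0)"
  by (auto simp: eqE_def)

definition entry :: "nat \<Rightarrow> expr \<Rightarrow> expr \<Rightarrow> expr" where
  "entry a i j = Read a (Plus (Read OFF i) j)"

definition relate :: "expr \<Rightarrow> expr \<Rightarrow> prog" where
  "relate i j = Write REL (Plus (Read OFF i) j) (Const 1)"

text \<open>On truth values 0 and 1, truncated subtraction is "and not". Every entry is written, so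
  the relation left over from the previous starting vertex is erased.\<close>

definition start_prog :: prog where
  "start_prog = For VI NV (For VJ NV (Write REL (Plus (Read OFF (Var VI)) (Var VJ))
     (Minus (eqE (Var VA) (Var VI)) (eqE (Var VA) (Var VJ)))))"

text \<open>\<open>Plus\<close> acts as disjunction and \<open>Minus\<close> as "and not". Comparing
  input cells compares adjacencies, since different bits have different cell values.\<close>

definition step_prog :: prog where
  "step_prog = If (entry REL (Var VI) (Var VJ))
     (Seq (If (Plus (entry REL (Var VJ) (Var VK))
              (Minus (eqE (entry INP (Var VI) (Var VJ)) (entry INP (Var VI) (Var VK)))
                     (eqE (entry INP (Var VI) (Var VJ)) (entry INP (Var VJ) (Var VK)))))
          (relate (Var VI) (Var VK)) Skip)
       (If (Minus (eqE (entry INP (Var VI) (Var VJ)) (entry INP (Var VK) (Var VJ)))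
                  (eqE (entry INP (Var VI) (Var VJ)) (entry INP (Var VI) (Var VK))))
          (relate (Var VK) (Var VJ)) Skip)) Skip"

definition round_prog :: prog where
  "round_prog = For VI NV (For VJ NV (For VK NV step_prog))"

text \<open>Two nested loops give \<open>n * n\<close> rounds in a model without multiplication;
  this number suffices for every input, so no test for a fixpoint is made.\<close>

definition closure_prog :: prog where
  "closure_prog = For VR NV (For VS NV round_prog)"

text \<open>\<open>GOOD\<close> tests the diagonal. If it fails, ranks may collide and
  \<open>PERM\<close> may be meaningless, but then \<open>search_prog\<close> skips the
  candidate.\<close>

definition rank_prog :: prog where
  "rank_prog = Seq (Set GOOD (Const 1)) (For VI NV (Seq (Set RANK (Const 0))
     (Seq (For VJ NV (Set RANK (Plus (Var RANK) (entry REL (Var VJ) (Var VI)))))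
     (Seq (Write PERM (Var RANK) (Var VI))
       (If (entry REL (Var VI) (Var VI)) (Set GOOD (Const 0)) Skip)))))"

lemma writes_closure_progs [simp]:
  "writes start_prog = {VI, VJ, REL}"
  "writes step_prog = {REL}"
  "writes round_prog = {VI, VJ, VK, REL}"
  "writes closure_prog = {VR, VS, VI, VJ, VK, REL}"
  "writes rank_prog = {GOOD, VI, RANK, VJ, PERM}"
  by (auto simp: start_prog_def step_prog_def round_prog_def closure_prog_def rank_prog_def relate_def)

lemma matrix_index_inject:
  assumes "j < n" "j' < n"
  shows "p + i * n + j = p + i' * n + j' \<longleftrightarrow> i = i' \<and> j = (j' :: nat)"
proof
  assume "p + i * n + j = p + i' * n + j'"
  then have *: "i * n + j = i' * n + j'" by simp
  then have "(i * n + j) div n = (i' * n + j') div n" by simp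
  then have "i = i'" using assms by simp
  then show "i = i' \<and> j = j'" using * by simp
qed simp

text \<open>Primality is represented by \<open>total\<close>, required for every starting vertex.
  Thus the program has to test nothing but irreflexivity to know that it has found a linear
  order.\<close>

locale indexed_graph =
  fixes n l p0 :: nat and A :: "nat \<Rightarrow> nat \<Rightarrow> bool" and c :: "nat \<Rightarrow> nat"
  assumes n_le: "n \<le> l"
    and total: "\<And>a x y. \<lbrakk>a < n; x < n; y < n; x \<noteq> y\<rbrakk> \<Longrightarrow>
      forced_less {..<n} A a x y \<or> forced_less {..<n} A a y x"
begin

definition env :: "memory \<Rightarrow> bool" where
  "env m \<longleftrightarrow> m NV 0 = n \<and> (\<forall>i < n. m OFF i = p0 + i * n) \<and>
     (\<forall>i < n. \<forall>j < n. m INP (p0 + i * n + j) = bit_cell (A i j)) \<and>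
     (\<forall>i < n. m CL i = length (encode_nat (c i)) \<and> m CL i \<le> l \<and>
       (\<forall>t < length (encode_nat (c i)). m INP (m CS i + t) = bit_cell (encode_nat (c i) ! t)))"

definition relm :: "nat rel \<Rightarrow> memory \<Rightarrow> bool" where
  "relm S m \<longleftrightarrow> (\<forall>i < n. \<forall>j < n. m REL (p0 + i * n + j) = (if (i, j) \<in> S then 1 else 0))"

lemma env_frame:
  "env m \<Longrightarrow> (\<And>a. a \<in> {INP, NV, CS, CL, OFF} \<Longrightarrow> m' a = m a) \<Longrightarrow> env m'"
proof -
  assume env: "env m" and fr: "\<And>a. a \<in> {INP, NV, CS, CL, OFF} \<Longrightarrow> m' a = m a"
  have eqs: "m' INP = m INP" "m' NV = m NV" "m' CS = m CS" "m' CL = m CL" "m' OFF = m OFF"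
    by (rule fr, simp)+
  show "env m'" using env unfolding env_def eqs .
qed

lemma envD:
  assumes "env m"
  shows "m NV 0 = n" "i < n \<Longrightarrow> m OFF i = p0 + i * n"
    "i < n \<Longrightarrow> j < n \<Longrightarrow> m INP (p0 + i * n + j) = bit_cell (A i j)"
    "i < n \<Longrightarrow> m CL i = length (encode_nat (c i))" "i < n \<Longrightarrow> length (encode_nat (c i)) \<le> l"
    "i < n \<Longrightarrow> t < length (encode_nat (c i)) \<Longrightarrow> m INP (m CS i + t) = bit_cell (encode_nat (c i) ! t)"
  using assms unfolding env_def by auto

lemma relm_update [simp]: "a \<noteq> REL \<Longrightarrow> relm S (m(a := x)) = relm S m"
  unfolding relm_def by simp

lemma relmD: "relm S m \<Longrightarrow> i < n \<Longrightarrow> j < n \<Longrightarrow> m REL (p0 + i * n + j) = (if (i, j) \<in> S then 1 else 0)"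
  unfolding relm_def by simp

lemma relm_insert:
  assumes "relm S m" "i < n" "j < n"
  shows "relm (insert (i, j) S) (m(REL := (m REL)(p0 + i * n + j := Suc 0)))"
  using assms unfolding relm_def by (simp add: matrix_index_inject)

section \<open>Correctness of the closure and the ranks\<close>

lemma runs_start:
  assumes env: "env m" and a: "m VA 0 = a"
  shows "runs start_prog m (loop_time l (loop_time l 1)) (relm {(a, j) | j. j < n \<and> j \<noteq> a})"
  unfolding start_prog_def
proof (rule runs_For[where I = "\<lambda>k m. \<forall>i' < k. \<forall>j < n. m REL (p0 + i' * n + j) = (if i' = a \<and> j \<noteq> a then 1 else 0)"
      and N = n and l = l and T = "loop_time l 1"])
  fix i m1 assume i: "i < n" "m1 VI 0 = i"
    and I: "\<forall>i' < i. \<forall>j < n. m1 REL (p0 + i' * n + j) = (if i' = a \<and> j \<noteq> a then 1 else 0)"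
    and fr: "\<And>b. b \<noteq> VI \<Longrightarrow> b \<notin> writes (For VJ NV (Write REL (Plus (Read OFF (Var VI)) (Var VJ))
       (Minus (eqE (Var VA) (Var VI)) (eqE (Var VA) (Var VJ))))) \<Longrightarrow> m1 b = m b"
  show "runs (For VJ NV (Write REL (Plus (Read OFF (Var VI)) (Var VJ))
       (Minus (eqE (Var VA) (Var VI)) (eqE (Var VA) (Var VJ))))) m1 (loop_time l 1)
     (\<lambda>m'. \<forall>i' < Suc i. \<forall>j < n. (m'(VI := (m' VI)(0 := Suc i))) REL (p0 + i' * n + j) =
        (if i' = a \<and> j \<noteq> a then 1 else 0))"
  proof (rule runs_For[where I = "\<lambda>k m. (\<forall>i' < i. \<forall>j' < n. m REL (p0 + i' * n + j') = (if i' = a \<and> j' \<noteq> a then 1 else 0)) \<and>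
      (\<forall>j' < k. m REL (p0 + i * n + j') = (if i = a \<and> j' \<noteq> a then 1 else 0))" and N = n and l = l and T = 1])
    fix j m2 assume j: "j < n" "m2 VJ 0 = j"
      and I2: "(\<forall>i' < i. \<forall>j' < n. m2 REL (p0 + i' * n + j') = (if i' = a \<and> j' \<noteq> a then 1 else 0)) \<and>
        (\<forall>j' < j. m2 REL (p0 + i * n + j') = (if i = a \<and> j' \<noteq> a then 1 else 0))"
      and fr2: "\<And>b. b \<noteq> VJ \<Longrightarrow> b \<notin> writes (Write REL (Plus (Read OFF (Var VI)) (Var VJ))
       (Minus (eqE (Var VA) (Var VI)) (eqE (Var VA) (Var VJ)))) \<Longrightarrow> m2 b = m1 b"
    have "m2 OFF i = p0 + i * n" using envD[OF env] i by (simp add: fr fr2)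
    then show "runs (Write REL (Plus (Read OFF (Var VI)) (Var VJ))
       (Minus (eqE (Var VA) (Var VI)) (eqE (Var VA) (Var VJ)))) m2 1
       (\<lambda>m'. (\<forall>i' < i. \<forall>j' < n. (m'(VJ := (m' VJ)(0 := Suc j))) REL (p0 + i' * n + j') = (if i' = a \<and> j' \<noteq> a then 1 else 0)) \<and>
        (\<forall>j' < Suc j. (m'(VJ := (m' VJ)(0 := Suc j))) REL (p0 + i * n + j') = (if i = a \<and> j' \<noteq> a then 1 else 0)))"
      using I2 i j a less_trans[OF _ j(1)] less_trans[OF _ i(1)]
      by (simp add: fr fr2 All_less_Suc matrix_index_inject)
  qed (use I n_le in \<open>simp_all add: fr All_less_Suc envD(1)[OF env]\<close>)
qed (use n_le in \<open>auto simp: relm_def envD(1)[OF env]\<close>)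

lemma runs_step:
  assumes env: "env m" and S: "relm S m" and ijk: "m VI 0 = i" "m VJ 0 = j" "m VK 0 = k" "i < n" "j < n" "k < n"
  shows "runs step_prog m 5 (relm (forced_step A i j k S))"
proof -
  note [simp] = envD(2,3)[OF env] relmD[OF S]
  have bc: "bit_cell x = bit_cell y \<longleftrightarrow> x = y" for x y by (auto simp: bit_cell_def)
  note ins = relm_insert[OF S]
  have ins2: "relm (insert (k, j) (insert (i, k) S))
     (m(REL := (m REL)(p0 + i * n + k := Suc 0, p0 + k * n + j := Suc 0)))"
    using relm_insert[OF ins[of i k], of k j] ijk by simp
  show ?thesis unfolding step_prog_def entry_def relate_def forced_step_def
    using ijk S ins[of i k] ins[of k j] ins2 by (simp add: bc)
qed

lemma runs_round:
  assumes env: "env m" and S: "relm S m"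
  shows "runs round_prog m (loop_time l (loop_time l (loop_time l 5))) (relm (forced_round n A S))"
  unfolding round_prog_def
proof (rule runs_For[where I = "\<lambda>k. relm (fold (\<lambda>i. fold (\<lambda>j. fold (forced_step A i j) [0..<n]) [0..<n]) [0..<k] S)"
      and N = n and l = l])
  fix i m1
  let ?S1 = "fold (\<lambda>i. fold (\<lambda>j. fold (forced_step A i j) [0..<n]) [0..<n]) [0..<i] S"
  assume i: "i < n" "m1 VI 0 = i" and S1: "relm ?S1 m1"
    and fr: "\<And>b. b \<noteq> VI \<Longrightarrow> b \<notin> writes (For VJ NV (For VK NV step_prog)) \<Longrightarrow> m1 b = m b"
  show "runs (For VJ NV (For VK NV step_prog)) m1 (loop_time l (loop_time l 5))
    (\<lambda>m'. relm (fold (\<lambda>i. fold (\<lambda>j. fold (forced_step A i j) [0..<n]) [0..<n]) [0..<Suc i] S) (m'(VI := (m' VI)(0 := Suc i))))"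
  proof (rule runs_For[where I = "\<lambda>k. relm (fold (\<lambda>j. fold (forced_step A i j) [0..<n]) [0..<k] ?S1)"
      and N = n and l = l])
    fix j m2
    let ?S2 = "fold (\<lambda>j. fold (forced_step A i j) [0..<n]) [0..<j] ?S1"
    assume j: "j < n" "m2 VJ 0 = j" and S2: "relm ?S2 m2"
      and fr2: "\<And>b. b \<noteq> VJ \<Longrightarrow> b \<notin> writes (For VK NV step_prog) \<Longrightarrow> m2 b = m1 b"
    show "runs (For VK NV step_prog) m2 (loop_time l 5)
      (\<lambda>m'. relm (fold (\<lambda>j. fold (forced_step A i j) [0..<n]) [0..<Suc j] ?S1) (m'(VJ := (m' VJ)(0 := Suc j))))"
    proof (rule runs_For[where I = "\<lambda>k. relm (fold (forced_step A i j) [0..<k] ?S2)" and N = n and l = l])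
      fix k m3
      assume k: "k < n" "m3 VK 0 = k" and S3: "relm (fold (forced_step A i j) [0..<k] ?S2) m3"
        and fr3: "\<And>b. b \<noteq> VK \<Longrightarrow> b \<notin> writes step_prog \<Longrightarrow> m3 b = m2 b"
      have "env m3" by (rule env_frame[OF env]) (auto simp: fr fr2 fr3)
      then have "runs step_prog m3 5 (relm (forced_step A i j k (fold (forced_step A i j) [0..<k] ?S2)))"
        using i j k by (intro runs_step S3) (auto simp: fr2 fr3)
      then show "runs step_prog m3 5 (\<lambda>m'. relm (fold (forced_step A i j) [0..<Suc k] ?S2) (m'(VK := (m' VK)(0 := Suc k))))"
        by (rule runs_mono) simp_all
    qed (use n_le S2 in \<open>simp_all add: fr fr2 envD(1)[OF env]\<close>)
  qed (use n_le S1 in \<open>simp_all add: fr envD(1)[OF env]\<close>)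
qed (use n_le S in \<open>simp_all add: forced_round_def envD(1)[OF env]\<close>)

lemma runs_closure:
  assumes env: "env m" and S: "relm S m"
  shows "runs closure_prog m (loop_time l (loop_time l (loop_time l (loop_time l (loop_time l 5)))))
    (relm ((forced_round n A ^^ (n * n)) S))"
  unfolding closure_prog_def
proof (rule runs_For[where I = "\<lambda>k. relm ((forced_round n A ^^ (k * n)) S)" and N = n and l = l])
  fix i m1
  assume i: "i < n" and S1: "relm ((forced_round n A ^^ (i * n)) S) m1"
    and fr: "\<And>b. b \<noteq> VR \<Longrightarrow> b \<notin> writes (For VS NV round_prog) \<Longrightarrow> m1 b = m b"
  show "runs (For VS NV round_prog) m1 (loop_time l (loop_time l (loop_time l (loop_time l 5))))
    (\<lambda>m'. relm ((forced_round n A ^^ (Suc i * n)) S) (m'(VR := (m' VR)(0 := Suc i))))"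
  proof (rule runs_For[where I = "\<lambda>k. relm ((forced_round n A ^^ (i * n + k)) S)" and N = n and l = l])
    fix j m2
    assume j: "j < n" and S2: "relm ((forced_round n A ^^ (i * n + j)) S) m2"
      and fr2: "\<And>b. b \<noteq> VS \<Longrightarrow> b \<notin> writes round_prog \<Longrightarrow> m2 b = m1 b"
    have "env m2" by (rule env_frame[OF env]) (auto simp: fr fr2)
    from runs_round[OF this S2]
    show "runs round_prog m2 (loop_time l (loop_time l (loop_time l 5)))
      (\<lambda>m'. relm ((forced_round n A ^^ (i * n + Suc j)) S) (m'(VS := (m' VS)(0 := Suc j))))"
      by (rule runs_mono) simp_all
  qed (use n_le S1 in \<open>simp_all add: fr envD(1)[OF env] add.commute\<close>)
qed (use n_le S in \<open>simp_all add: envD(1)[OF env]\<close>)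

lemma card_less_Suc_filter:
  "card {j. j < Suc k \<and> P j} = card {j. j < k \<and> P j} + (if P k then 1 else 0)"
proof -
  have "{j. j < Suc k \<and> P j} = (if P k then insert k {j. j < k \<and> P j} else {j. j < k \<and> P j})"
    by (auto simp: less_Suc_eq)
  then show ?thesis by simp
qed

lemma runs_rank:
  assumes env: "env m" and S: "relm S m"
  defines "rank \<equiv> \<lambda>i. card {j. j < n \<and> (j, i) \<in> S}"
  shows "runs rank_prog m (loop_time l (loop_time l 1 + 4) + 1) (\<lambda>m'.
    (m' GOOD 0 \<noteq> 0 \<longleftrightarrow> (\<forall>i < n. (i, i) \<notin> S)) \<and>
    (inj_on rank {..<n} \<longrightarrow> (\<forall>i < n. m' PERM (rank i) = i)))"
proof -
  let ?inner = "For VJ NV (Set RANK (Plus (Var RANK) (entry REL (Var VJ) (Var VI))))"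
  let ?rest = "Seq (Write PERM (Var RANK) (Var VI)) (If (entry REL (Var VI) (Var VI)) (Set GOOD (Const 0)) Skip)"
  let ?I = "\<lambda>k m'. (m' GOOD 0 \<noteq> 0 \<longleftrightarrow> (\<forall>i < k. (i, i) \<notin> S)) \<and>
    (inj_on rank {..<n} \<longrightarrow> (\<forall>i < k. m' PERM (rank i) = i))"
  let ?m = "m(GOOD := (m GOOD)(0 := 1))"
  have "runs (For VI NV (Seq (Set RANK (Const 0)) (Seq ?inner ?rest))) ?m (loop_time l (loop_time l 1 + 4)) (?I n)"
  proof (rule runs_For[where I = ?I and N = n and l = l and T = "loop_time l 1 + 4"])
    fix i m1
    assume i: "i < n" "m1 VI 0 = i" and I: "?I i m1"
      and fr: "\<And>b. b \<noteq> VI \<Longrightarrow> b \<notin> writes (Seq (Set RANK (Const 0)) (Seq ?inner ?rest)) \<Longrightarrow> m1 b = ?m b"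
    let ?m1 = "m1(RANK := (m1 RANK)(0 := 0))"
    have "runs ?inner ?m1 (loop_time l 1) (\<lambda>m'. runs ?rest m' 3 (\<lambda>m'. ?I (Suc i) (m'(VI := (m' VI)(0 := Suc i)))))"
    proof (rule runs_For[where I = "\<lambda>k m'. m' RANK 0 = card {j. j < k \<and> (j, i) \<in> S}" and N = n and l = l and T = 1])
      fix j m2
      assume j: "j < n" "m2 VJ 0 = j" and I2: "m2 RANK 0 = card {j'. j' < j \<and> (j', i) \<in> S}"
        and fr2: "\<And>b. b \<noteq> VJ \<Longrightarrow> b \<notin> writes (Set RANK (Plus (Var RANK) (entry REL (Var VJ) (Var VI)))) \<Longrightarrow> m2 b = ?m1 b"
      have "m2 OFF j = p0 + j * n" "m2 REL (p0 + j * n + i) = (if (j, i) \<in> S then 1 else 0)" "m2 VI 0 = i"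
        using envD(2)[OF env] relmD[OF S] i j by (simp_all add: fr fr2)
      then show "runs (Set RANK (Plus (Var RANK) (entry REL (Var VJ) (Var VI)))) m2 1
        (\<lambda>m'. (m'(VJ := (m' VJ)(0 := Suc j))) RANK 0 = card {j'. j' < Suc j \<and> (j', i) \<in> S})"
        using I2 j i by (simp add: entry_def card_less_Suc_filter)
    next
      fix m2 assume I2: "m2 RANK 0 = card {j'. j' < n \<and> (j', i) \<in> S}"
        and fr2: "\<And>b. b \<noteq> VJ \<Longrightarrow> b \<notin> writes (Set RANK (Plus (Var RANK) (entry REL (Var VJ) (Var VI)))) \<Longrightarrow> m2 b = ?m1 b"
      have 1: "m2 OFF i = p0 + i * n" "m2 REL (p0 + i * n + i) = (if (i, i) \<in> S then 1 else 0)" "m2 VI 0 = i"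
        using envD(2)[OF env] relmD[OF S] i by (simp_all add: fr fr2)
      have 2: "m2 GOOD = m1 GOOD" "m2 PERM = m1 PERM" by (simp_all add: fr2)
      \<comment> \<open>With distinct ranks, writing vertex i into \<open>PERM\<close> leaves the
        entries of earlier vertices intact.\<close>
      have 3: "rank i' \<noteq> rank i" if "inj_on rank {..<n}" "i' < i" for i'
        using inj_onD[OF that(1), of i' i] that(2) i by auto
      have R: "m2 RANK 0 = rank i" using I2 by (simp add: rank_def)
      show "runs ?rest m2 3 (\<lambda>m'. ?I (Suc i) (m'(VI := (m' VI)(0 := Suc i))))"
        using I 1 2 3 R
        by (cases "inj_on rank {..<n}") (simp_all add: entry_def All_less_Suc)
    qed (use n_le in \<open>simp_all add: fr envD(1)[OF env]\<close>)
    from runs_Seq[OF this]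
    show "runs (Seq (Set RANK (Const 0)) (Seq ?inner ?rest)) m1 (loop_time l 1 + 4) (\<lambda>m'. ?I (Suc i) (m'(VI := (m' VI)(0 := Suc i))))"
      by (simp add: add.commute[of 3])
  qed (use n_le in \<open>simp_all add: envD(1)[OF env]\<close>)
  then show ?thesis unfolding rank_prog_def by simp
qed

end

section \<open>Searching for the largest word\<close>

text \<open>The stored value of a bit, 1 or 2, is also its digit in \<open>word_value\<close>, so a
  single expression serves both the array and the running value. It is evaluated again after
  \<open>CAND\<close> has changed and so must not depend on that array.\<close>

definition emit :: "expr \<Rightarrow> prog" where
  "emit e = Seq (Write CAND (Var OUTP) e)
     (Seq (Set VAL (Plus (Plus (Var VAL) (Var VAL)) e)) (Set OUTP (Plus (Var OUTP) (Const 1))))"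

definition colors_prog :: prog where
  "colors_prog = For VR NV (Seq (Set VX (Read PERM (Var VR))) (Seq (Set VB (Read CL (Var VX)))
     (For VS VB (emit (Read INP (Plus (Read CS (Var VX)) (Var VS)))))))"

definition matrix_prog :: prog where
  "matrix_prog = For VR NV (For VS NV (emit (entry INP (Read PERM (Var VR)) (Read PERM (Var VS)))))"

text \<open>Candidates are laid out one behind the other, as \<open>OUTP\<close> is never reset. The
  best one stays where it was written and is remembered by its start and length, so nothing is
  copied before the output.\<close>

definition candidate_prog :: prog where
  "candidate_prog = Seq (Set START (Var OUTP)) (Seq (Set VAL (Const 0)) (Seq colors_prog (Seq matrix_prog
     (If (Minus (Var VAL) (Var BEST))
       (Seq (Set BEST (Var VAL)) (Seq (Set BS (Var START)) (Set BL (Minus (Var OUTP) (Var START))))) Skip))))"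

definition search_prog :: prog where
  "search_prog = For VA NV (Seq start_prog (Seq closure_prog (Seq rank_prog (If (Var GOOD) candidate_prog Skip))))"

lemma writes_candidate_progs [simp]:
  "writes (emit e) = {CAND, VAL, OUTP}"
  "writes colors_prog = {VR, VX, VB, VS, CAND, VAL, OUTP}"
  "writes matrix_prog = {VR, VS, CAND, VAL, OUTP}"
  "writes candidate_prog = {START, VAL, VR, VX, VB, VS, CAND, OUTP, BEST, BS, BL}"
  by (auto simp: emit_def colors_prog_def matrix_prog_def candidate_prog_def)

section \<open>Correctness of the search\<close>

definition cand :: "(nat \<Rightarrow> nat) \<Rightarrow> nat \<Rightarrow> bool list \<Rightarrow> memory \<Rightarrow> bool" where
  "cand M s u m \<longleftrightarrow> m OUTP 0 = s + length u \<and> m VAL 0 = word_value u \<and>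
     (\<forall>i < length u. m CAND (s + i) = bit_cell (u ! i)) \<and> (\<forall>i < s. m CAND i = M i)"

lemma cand_update [simp]: "a \<notin> {CAND, VAL, OUTP} \<Longrightarrow> cand M s u (m(a := x)) = cand M s u m"
  unfolding cand_def by simp

lemma runs_emit:
  assumes "cand M s u m" "eval_expr e m = bit_cell b"
    "\<And>x. eval_expr e (m(CAND := x)) = eval_expr e m"
  shows "runs (emit e) m 3 (cand M s (u @ [b]))"
  using assms unfolding emit_def cand_def by (auto simp: nth_append less_Suc_eq)

lemma length_concat_le:
  "(\<And>x. x \<in> set xs \<Longrightarrow> length (f x) \<le> k) \<Longrightarrow> length (concat (map f xs)) \<le> length xs * k"
  by (induction xs) (auto intro: add_mono)

definition candidate_time :: "nat \<Rightarrow> nat" where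
  "candidate_time l = loop_time l (loop_time l 3 + 2) + (loop_time l (loop_time l 3) + 4) + 2"

definition search_time :: "nat \<Rightarrow> nat" where
  "search_time l = loop_time l (loop_time l (loop_time l 1) +
     (loop_time l (loop_time l (loop_time l (loop_time l (loop_time l 5)))) +
     ((loop_time l (loop_time l 1 + 4) + 1) + (candidate_time l + 1))))"

context indexed_graph
begin

lemma runs_colors:
  assumes env: "env m" and g: "\<And>i. i < n \<Longrightarrow> m PERM i < n" and u: "cand M s u m"
  shows "runs colors_prog m (loop_time l (loop_time l 3 + 2))
    (cand M s (u @ concat (map (\<lambda>i. encode_nat (c (m PERM i))) [0..<n])))"
  unfolding colors_prog_def
proof (rule runs_For[where I = "\<lambda>k. cand M s (u @ concat (map (\<lambda>i. encode_nat (c (m PERM i))) [0..<k]))"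
    and N = n and l = l and T = "loop_time l 3 + 2"])
  fix i m1
  let ?u = "u @ concat (map (\<lambda>i. encode_nat (c (m PERM i))) [0..<i])"
  let ?x = "m PERM i"
  let ?code = "encode_nat (c ?x)"
  let ?body = "emit (Read INP (Plus (Read CS (Var VX)) (Var VS)))"
  assume i: "i < n" "m1 VR 0 = i" and u: "cand M s ?u m1"
    and fr: "\<And>b. b \<noteq> VR \<Longrightarrow> b \<notin> writes (Seq (Set VX (Read PERM (Var VR))) (Seq (Set VB (Read CL (Var VX)))
       (For VS VB ?body))) \<Longrightarrow> m1 b = m b"
  have x: "?x < n" using g i by simp
  let ?m1 = "m1(VX := (m1 VX)(0 := ?x), VB := (m1 VB)(0 := length ?code))"
  have "runs (For VS VB ?body) ?m1 (loop_time l 3) (\<lambda>m'. cand M s (?u @ ?code) (m'(VR := (m' VR)(0 := Suc i))))"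
  proof (rule runs_For[where I = "\<lambda>k. cand M s (?u @ take k ?code)" and N = "length ?code" and l = l and T = 3])
    fix t m2
    assume t: "t < length ?code" "m2 VS 0 = t" and u2: "cand M s (?u @ take t ?code) m2"
      and fr2: "\<And>b. b \<noteq> VS \<Longrightarrow> b \<notin> writes ?body \<Longrightarrow> m2 b = ?m1 b"
    have "runs ?body m2 3 (cand M s ((?u @ take t ?code) @ [?code ! t]))"
      by (rule runs_emit[OF u2]) (use t envD(6)[OF env x] in \<open>simp_all add: fr fr2\<close>)
    then show "runs ?body m2 3 (\<lambda>m'. cand M s (?u @ take (Suc t) ?code) (m'(VS := (m' VS)(0 := Suc t))))"
      using t by (simp add: take_Suc_conv_app_nth)
  qed (use u envD(5)[OF env x] in simp_all)
  then show "runs (Seq (Set VX (Read PERM (Var VR))) (Seq (Set VB (Read CL (Var VX))) (For VS VB ?body))) m1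
      (loop_time l 3 + 2) (\<lambda>m'. cand M s (u @ concat (map (\<lambda>i. encode_nat (c (m PERM i))) [0..<Suc i]))
        (m'(VR := (m' VR)(0 := Suc i))))"
    using i x envD(4)[OF env x] by (simp add: fr)
qed (use u n_le in \<open>simp_all add: envD(1)[OF env]\<close>)

lemma runs_matrix:
  assumes env: "env m" and g: "\<And>i. i < n \<Longrightarrow> m PERM i < n" and u: "cand M s u m"
  shows "runs matrix_prog m (loop_time l (loop_time l 3))
    (cand M s (u @ concat (map (\<lambda>i. map (\<lambda>j. A (m PERM i) (m PERM j)) [0..<n]) [0..<n])))"
  unfolding matrix_prog_def
proof (rule runs_For[where I = "\<lambda>k. cand M s (u @ concat (map (\<lambda>i. map (\<lambda>j. A (m PERM i) (m PERM j)) [0..<n]) [0..<k]))"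
    and N = n and l = l and T = "loop_time l 3"])
  fix i m1
  let ?u = "u @ concat (map (\<lambda>i. map (\<lambda>j. A (m PERM i) (m PERM j)) [0..<n]) [0..<i])"
  let ?body = "emit (entry INP (Read PERM (Var VR)) (Read PERM (Var VS)))"
  assume i: "i < n" "m1 VR 0 = i" and u: "cand M s ?u m1"
    and fr: "\<And>b. b \<noteq> VR \<Longrightarrow> b \<notin> writes (For VS NV ?body) \<Longrightarrow> m1 b = m b"
  show "runs (For VS NV ?body) m1 (loop_time l 3)
    (\<lambda>m'. cand M s (u @ concat (map (\<lambda>i. map (\<lambda>j. A (m PERM i) (m PERM j)) [0..<n]) [0..<Suc i])) (m'(VR := (m' VR)(0 := Suc i))))"
  proof (rule runs_For[where I = "\<lambda>k. cand M s (?u @ map (\<lambda>j. A (m PERM i) (m PERM j)) [0..<k])" and N = n and l = l and T = 3])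
    fix j m2
    assume j: "j < n" "m2 VS 0 = j" and u2: "cand M s (?u @ map (\<lambda>j. A (m PERM i) (m PERM j)) [0..<j]) m2"
      and fr2: "\<And>b. b \<noteq> VS \<Longrightarrow> b \<notin> writes ?body \<Longrightarrow> m2 b = m1 b"
    have "runs ?body m2 3 (cand M s ((?u @ map (\<lambda>j. A (m PERM i) (m PERM j)) [0..<j]) @ [A (m PERM i) (m PERM j)]))"
      by (rule runs_emit[OF u2])
        (use i j g envD(2,3)[OF env] in \<open>simp_all add: fr fr2 entry_def\<close>)
    then show "runs ?body m2 3 (\<lambda>m'. cand M s (?u @ map (\<lambda>j. A (m PERM i) (m PERM j)) [0..<Suc j]) (m'(VS := (m' VS)(0 := Suc j))))"
      by simp
  qed (use u n_le in \<open>simp_all add: fr envD(1)[OF env]\<close>)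
qed (use u n_le in \<open>simp_all add: envD(1)[OF env]\<close>)

text \<open>The case u = [] describes the initial memory, where no word has been seen. That the best
  word ends at or before \<open>OUTP\<close> protects it from later candidates.\<close>

definition best :: "bool list set \<Rightarrow> memory \<Rightarrow> bool" where
  "best W m \<longleftrightarrow> (\<exists>u. (u = [] \<or> u \<in> W) \<and> (\<forall>w \<in> W. word_value w \<le> word_value u) \<and>
     m BEST 0 = word_value u \<and> m BL 0 = length u \<and> m BS 0 + length u \<le> m OUTP 0 \<and>
     (\<forall>i < length u. m CAND (m BS 0 + i) = bit_cell (u ! i)))"

lemma best_frame:
  "best W m \<Longrightarrow> (\<And>a. a \<in> {BEST, BL, BS, OUTP, CAND} \<Longrightarrow> m' a = m a) \<Longrightarrow> best W m'"
proof -
  assume b: "best W m" and fr: "\<And>a. a \<in> {BEST, BL, BS, OUTP, CAND} \<Longrightarrow> m' a = m a"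
  have eqs: "m' BEST = m BEST" "m' BL = m BL" "m' BS = m BS" "m' OUTP = m OUTP" "m' CAND = m CAND"
    by (rule fr, simp)+
  show "best W m'" using b unfolding best_def eqs .
qed

lemma best_insert:
  assumes best: "best W m" and cand: "cand (m CAND) (m OUTP 0) w m'"
    and fr: "m' BEST = m BEST" "m' BL = m BL" "m' BS = m BS"
  shows "word_value w \<le> m BEST 0 \<Longrightarrow> best (insert w W) m'"
    and "word_value w > m BEST 0 \<Longrightarrow> m'' BEST 0 = word_value w \<Longrightarrow> m'' BS 0 = m OUTP 0 \<Longrightarrow>
      m'' BL 0 = length w \<Longrightarrow> m'' CAND = m' CAND \<Longrightarrow> m'' OUTP = m' OUTP \<Longrightarrow> best (insert w W) m''"
proof -
  obtain u where u: "u = [] \<or> u \<in> W" "\<forall>w \<in> W. word_value w \<le> word_value u"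
     "m BEST 0 = word_value u" "m BL 0 = length u" "m BS 0 + length u \<le> m OUTP 0"
     "\<forall>i < length u. m CAND (m BS 0 + i) = bit_cell (u ! i)"
    using best unfolding best_def by blast
  show "best (insert w W) m'" if "word_value w \<le> m BEST 0"
    unfolding best_def by (rule exI[of _ u]) (use u that cand fr in \<open>auto simp: cand_def\<close>)
  show "best (insert w W) m''" if "word_value w > m BEST 0" "m'' BEST 0 = word_value w" "m'' BS 0 = m OUTP 0"
      "m'' BL 0 = length w" "m'' CAND = m' CAND" "m'' OUTP = m' OUTP"
    unfolding best_def by (rule exI[of _ w]) (use u that cand in \<open>auto simp: cand_def intro: order.trans less_imp_le\<close>)
qed

lemma runs_candidate:
  assumes env: "env m" and g: "\<And>i. i < n \<Longrightarrow> m PERM i < n" and best: "best W m"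
  shows "runs candidate_prog m (candidate_time l)
    (best (insert (listing_word A c (map (m PERM) [0..<n])) W))"
proof -
  let ?w = "listing_word A c (map (m PERM) [0..<n])"
  let ?u = "concat (map (\<lambda>i. encode_nat (c (m PERM i))) [0..<n])"
  let ?v = "concat (map (\<lambda>i. map (\<lambda>j. A (m PERM i) (m PERM j)) [0..<n]) [0..<n])"
  let ?last = "If (Minus (Var VAL) (Var BEST))
       (Seq (Set BEST (Var VAL)) (Seq (Set BS (Var START)) (Set BL (Minus (Var OUTP) (Var START))))) Skip"
  let ?m0 = "m(START := (m START)(0 := m OUTP 0), VAL := (m VAL)(0 := 0))"
  let ?cand = "cand (m CAND) (m OUTP 0)"
  have w: "?w = ?u @ ?v" by (simp add: listing_word_def comp_def)
  have 0: "?cand [] ?m0" by (simp add: cand_def)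
  have env0: "env ?m0" by (rule env_frame[OF env]) auto
  have "runs colors_prog ?m0 (loop_time l (loop_time l 3 + 2)) (\<lambda>m1. runs (Seq matrix_prog ?last) m1
    (loop_time l (loop_time l 3) + 4) (best (insert ?w W)))"
  proof (rule runs_frame[OF runs_colors[OF env0 _ 0]])
    fix m1 assume c1: "?cand ([] @ concat (map (\<lambda>i. encode_nat (c (?m0 PERM i))) [0..<n])) m1"
      and fr1: "\<And>a. a \<notin> writes colors_prog \<Longrightarrow> m1 a = ?m0 a"
    have env1: "env m1" by (rule env_frame[OF env]) (auto simp: fr1)
    have p1: "m1 PERM = m PERM" by (simp add: fr1)
    have c1': "?cand ?u m1" using c1 by simp
    have "runs matrix_prog m1 (loop_time l (loop_time l 3)) (\<lambda>m2. runs ?last m2 4 (best (insert ?w W)))"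
    proof (rule runs_frame[OF runs_matrix[OF env1 _ c1']])
      fix m2 assume c2: "?cand (?u @ concat (map (\<lambda>i. map (\<lambda>j. A (m1 PERM i) (m1 PERM j)) [0..<n]) [0..<n])) m2"
        and fr2: "\<And>a. a \<notin> writes matrix_prog \<Longrightarrow> m2 a = m1 a"
      have c2': "?cand ?w m2" using c2 unfolding w p1 .
      have fr3: "m2 BEST = m BEST" "m2 BL = m BL" "m2 BS = m BS" "m2 START 0 = m OUTP 0"
        by (simp_all add: fr1 fr2)
      have v: "m2 VAL 0 = word_value ?w" "m2 OUTP 0 = m OUTP 0 + length ?w" using c2' by (simp_all add: cand_def)
      note bi = best_insert[OF best c2' fr3(1-3)]
      show "runs ?last m2 4 (best (insert ?w W))"
      proof (cases "word_value ?w \<le> m BEST 0")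
        case True
        then show ?thesis using bi(1) by (simp add: fr3 v)
      next
        case False
        then show ?thesis using fr3 v by (auto intro!: bi(2))
      qed
    qed (use g in \<open>simp_all add: p1\<close>)
    from runs_Seq[OF this]
    show "runs (Seq matrix_prog ?last) m1 (loop_time l (loop_time l 3) + 4) (best (insert ?w W))" .
  qed (use g in simp_all)
  from runs_Seq[OF this] show ?thesis
    unfolding candidate_prog_def candidate_time_def by (simp add: ac_simps)
qed

definition words_below :: "nat \<Rightarrow> bool list set" where
  "words_below k = {listing_word A c xs | xs a. a < k \<and> forced_listing {..<n} A a xs}"

lemma words_below_Suc_eq:
  "words_below (Suc k) = words_below k \<union> {listing_word A c xs | xs. forced_listing {..<n} A k xs}"
  unfolding words_below_def less_Suc_eq by blast

lemma words_below_Suc: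
  assumes "forced_listing {..<n} A k xs"
  shows "words_below (Suc k) = insert (listing_word A c xs) (words_below k)"
proof -
  have "xs' = xs" if "forced_listing {..<n} A k xs'" for xs'
    by (rule forced_listing_unique[OF that assms])
  then show ?thesis unfolding words_below_Suc_eq using assms by blast
qed

lemma words_below_Suc_skip:
  "(\<And>xs. \<not> forced_listing {..<n} A k xs) \<Longrightarrow> words_below (Suc k) = words_below k"
  unfolding words_below_Suc_eq by simp

lemma runs_search:
  assumes env: "env m" and m: "m BEST 0 = 0" "m BL 0 = 0" "m BS 0 = 0"
  shows "runs search_prog m (search_time l) (best (words_below n))"
  unfolding search_prog_def
proof (rule runs_For[where I = "\<lambda>k. best (words_below k)" and N = n and l = l])
  fix a m1
  let ?P3 = "Seq rank_prog (If (Var GOOD) candidate_prog Skip)"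
  let ?P2 = "Seq closure_prog ?P3"
  let ?Q = "\<lambda>m'. best (words_below (Suc a)) (m'(VA := (m' VA)(0 := Suc a)))"
  assume a: "a < n" "m1 VA 0 = a" and best1: "best (words_below a) m1"
    and fr1: "\<And>b. b \<noteq> VA \<Longrightarrow> b \<notin> writes (Seq start_prog ?P2) \<Longrightarrow> m1 b = m b"
  let ?L = "{(i, j). forced_less {..<n} A a i j}"
  have env1: "env m1" by (rule env_frame[OF env]) (auto simp: fr1)
  \<comment> \<open>The subprograms are treated from last to first, so that each result can serve as
    the postcondition that \<open>runs_Seq\<close> asks of the preceding one.\<close>
  have P4: "runs (If (Var GOOD) candidate_prog Skip) m4 (candidate_time l + 1) ?Q"
    if env4: "env m4" and best4: "best (words_below a) m4"
      and good: "m4 GOOD 0 \<noteq> 0 \<longleftrightarrow> (\<forall>i < n. (i, i) \<notin> ?L)"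
      and perm: "inj_on (\<lambda>i. card {j. j < n \<and> (j, i) \<in> ?L}) {..<n} \<longrightarrow>
        (\<forall>i < n. m4 PERM (card {j. j < n \<and> (j, i) \<in> ?L}) = i)" for m4
  proof (cases "m4 GOOD 0 = 0")
    case True
    then obtain i where i: "i < n" "forced_less {..<n} A a i i" using good by auto
    \<comment> \<open>A listing relates no vertex to itself, so skipping this \<open>a\<close> loses
      no word.\<close>
    have "\<not> forced_listing {..<n} A a xs" for xs
    proof
      assume xs: "forced_listing {..<n} A a xs"
      then have "i \<in> set xs" using i by (simp add: forced_listing_def)
      then obtain k where "k < length xs" "xs ! k = i" by (auto simp: in_set_conv_nth)
      then show False using xs i unfolding forced_listing_def by (metis less_irrefl)
    qed
    then have "words_below (Suc a) = words_below a" by (rule words_below_Suc_skip)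
    moreover have "best (words_below a) (m4(VA := (m4 VA)(0 := Suc a)))" by (rule best_frame[OF best4]) auto
    ultimately show ?thesis using True by (simp add: candidate_time_def)
  next
    case False
    define rank where "rank = (\<lambda>i. card {j. j < n \<and> forced_less {..<n} A a j i})"
    have irr: "\<not> forced_less {..<n} A a i i" if "i < n" for i using False good that by simp
    have bij: "bij_betw rank {..<n} {..<n}"
      by (rule forced_listing_ranks(1)[where A = A and a = a])
        (use total[OF a(1)] a(1) irr in \<open>simp_all add: rank_def\<close>)
    have perm': "m4 PERM (rank i) = i" if "i < n" for i
      using perm bij that by (simp add: rank_def bij_betw_def)
    have list: "forced_listing {..<n} A a (map (m4 PERM) [0..<n])"
      by (rule forced_listing_ranks(2)[where rank = rank])
        (use total[OF a(1)] a(1) irr perm' in \<open>simp_all add: rank_def\<close>)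
    have lt: "m4 PERM i < n" if "i < n" for i
    proof -
      have "m4 PERM i \<in> set (map (m4 PERM) [0..<n])" using that by simp
      then show ?thesis using list unfolding forced_listing_def by blast
    qed
    have "runs candidate_prog m4 (candidate_time l) ?Q"
      by (rule runs_mono[OF runs_candidate[OF env4 lt best4]])
        (auto simp: words_below_Suc[OF list] elim: best_frame)
    then show ?thesis using False by simp
  qed
  have P3: "runs ?P3 m3 ((loop_time l (loop_time l 1 + 4) + 1) + (candidate_time l + 1)) ?Q"
    if env3: "env m3" and best3: "best (words_below a) m3" and rel3: "relm ?L m3" for m3
  proof (rule runs_Seq, rule runs_frame[OF runs_rank[OF env3 rel3]], rule P4)
    fix m4 assume fr: "\<And>b. b \<notin> writes rank_prog \<Longrightarrow> m4 b = m3 b"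
    show "env m4" by (rule env_frame[OF env3]) (auto simp: fr)
    show "best (words_below a) m4" by (rule best_frame[OF best3]) (auto simp: fr)
  qed auto
  have P2: "runs ?P2 m2 (loop_time l (loop_time l (loop_time l (loop_time l (loop_time l 5)))) +
     ((loop_time l (loop_time l 1 + 4) + 1) + (candidate_time l + 1))) ?Q"
    if env2: "env m2" and best2: "best (words_below a) m2" and rel2: "relm {(a, j) | j. j < n \<and> j \<noteq> a} m2" for m2
  proof (rule runs_Seq, rule runs_frame[OF runs_closure[OF env2 rel2]], rule P3)
    fix m3 assume fr: "\<And>b. b \<notin> writes closure_prog \<Longrightarrow> m3 b = m2 b"
      and rel: "relm ((forced_round n A ^^ (n * n)) {(a, j) |j. j < n \<and> j \<noteq> a}) m3"
    show "env m3" by (rule env_frame[OF env2]) (auto simp: fr)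
    show "best (words_below a) m3" by (rule best_frame[OF best2]) (auto simp: fr)
    show "relm ?L m3" using rel unfolding forced_round_closure[OF a(1)] .
  qed auto
  show "runs (Seq start_prog ?P2) m1 (loop_time l (loop_time l 1) +
     (loop_time l (loop_time l (loop_time l (loop_time l (loop_time l 5)))) +
     ((loop_time l (loop_time l 1 + 4) + 1) + (candidate_time l + 1)))) ?Q"
  proof (rule runs_Seq, rule runs_frame[OF runs_start[OF env1 a(2)]], rule P2)
    fix m2 assume fr: "\<And>b. b \<notin> writes start_prog \<Longrightarrow> m2 b = m1 b"
    show "env m2" by (rule env_frame[OF env1]) (auto simp: fr)
    show "best (words_below a) m2" by (rule best_frame[OF best1]) (auto simp: fr)
  qed auto
qed (use n_le m in \<open>auto simp: envD(1)[OF env] best_def words_below_def search_time_def\<close>)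

end

section \<open>Parsing, output and the main theorem\<close>

text \<open>Only the number of vertices is needed as a value. Vertex numbers are decoded to get past
  them, and colors to locate the ends of their codes, which are later copied bit by bit. Row offsets
  are built by repeated addition for want of multiplication.\<close>

definition parse_prog :: prog where
  "parse_prog = Seq decode (Seq (Set NV (Var ACC)) (Seq (Set HDR (Var POS)) (Seq
     (For VI NV (Seq decode (Seq (Write CS (Var VI) (Var POS))
        (Seq decode (Write CL (Var VI) (Minus (Var POS) (Read CS (Var VI))))))))
     (For VI NV (Seq (Write OFF (Var VI) (Var POS)) (Set POS (Plus (Var POS) (Var NV))))))))"

text \<open>The code of the number of vertices at the front of the input is kept as the prefix of
  the output. The word overwrites what follows it, and the end marker cuts off any remaining
  input.\<close>

definition output_prog :: prog where
  "output_prog = Seq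
     (For VI BL (Write INP (Plus (Var HDR) (Var VI)) (Read CAND (Plus (Var BS) (Var VI)))))
     (Write INP (Plus (Var HDR) (Var BL)) (Const 0))"

definition main_prog :: prog where
  "main_prog = Seq parse_prog (Seq search_prog output_prog)"

lemma upt_split: "k < n \<Longrightarrow> [0..<n] = [0..<k] @ k # [Suc k..<n]"
  by (metis less_imp_le_nat upt_add_eq_append upt_conv_Cons le_add_diff_inverse zero_le)

lemma length_concat_rows: "length (concat (map (\<lambda>i. map (f i) [0..<n]) [0..<k])) = k * n"
  by (induction k) auto

lemma nth_concat_rows:
  assumes "i < k" "j < n"
  shows "concat (map (\<lambda>i. map (f i) [0..<n]) [0..<k]) ! (i * n + j) = f i j"
proof -
  have "concat (map (\<lambda>i. map (f i) [0..<n]) [0..<k]) =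
      concat (map (\<lambda>i. map (f i) [0..<n]) [0..<i]) @ map (f i) [0..<n] @
      concat (map (\<lambda>i. map (f i) [0..<n]) [Suc i..<k])"
    by (subst upt_split[OF assms(1)]) simp
  then show ?thesis using assms(2) by (simp add: nth_append length_concat_rows)
qed

definition parse_time :: "nat \<Rightarrow> nat" where
  "parse_time l = (5 * l + 3) + (2 + (loop_time l ((5 * l + 3) + (1 + ((5 * l + 3) + 1))) + loop_time l 2))"

locale encoded_graph = indexed_graph +
  fixes v :: "nat \<Rightarrow> nat" and w :: "bool list"
  assumes w: "w = encode_nat n @ concat (map (\<lambda>i. encode_nat (v i) @ encode_nat (c i)) [0..<n]) @
      concat (map (\<lambda>i. map (A i) [0..<n]) [0..<n])"
    and p0: "p0 = length (encode_nat n @ concat (map (\<lambda>i. encode_nat (v i) @ encode_nat (c i)) [0..<n]))"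
    and l: "l = length w"
begin

definition header :: "nat \<Rightarrow> bool list" where
  "header k = encode_nat n @ concat (map (\<lambda>i. encode_nat (v i) @ encode_nat (c i)) [0..<k])"

lemma header_Suc: "header (Suc k) = header k @ encode_nat (v k) @ encode_nat (c k)"
  by (simp add: header_def)

lemma w_split:
  assumes "k < n"
  obtains r where "w = header k @ encode_nat (v k) @ encode_nat (c k) @ r"
  unfolding w header_def upt_split[OF assms] by simp

lemma header_n: "w = header n @ concat (map (\<lambda>i. map (A i) [0..<n]) [0..<n])" "p0 = length (header n)"
  by (simp_all add: w header_def p0)

lemma runs_parse:
  assumes m: "\<And>i. i < length w \<Longrightarrow> m INP i = bit_cell (w ! i)" and pos: "m POS 0 = 0"
  shows "runs parse_prog m (parse_time l) (\<lambda>m'. env m' \<and> m' HDR 0 = length (encode_nat n))"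
proof -
  let ?b1 = "Seq decode (Seq (Write CS (Var VI) (Var POS))
        (Seq decode (Write CL (Var VI) (Minus (Var POS) (Read CS (Var VI))))))"
  let ?b2 = "Seq (Write OFF (Var VI) (Var POS)) (Set POS (Plus (Var POS) (Var NV)))"
  let ?T = "(5 * l + 3) + (1 + ((5 * l + 3) + 1))"
  let ?Q = "\<lambda>m'. env m' \<and> m' HDR 0 = length (encode_nat n)"
  let ?I1 = "\<lambda>k m'. m' POS 0 = length (header k) \<and>
    (\<forall>i < k. m' CL i = length (encode_nat (c i)) \<and> m' CS i = length (header i @ encode_nat (v i)))"
  have loop2: "runs (For VI NV ?b2) m2 (loop_time l 2) ?Q"
    if I: "?I1 n m2" and inp: "m2 INP = m INP" and nv: "m2 NV 0 = n" and hdr: "m2 HDR 0 = length (encode_nat n)" for m2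
  proof (rule runs_For[where I = "\<lambda>k m'. m' POS 0 = p0 + k * n \<and> (\<forall>i < k. m' OFF i = p0 + i * n)"
      and N = n and l = l and T = 2])
    fix k m3 assume "k < n" "m3 POS 0 = p0 + k * n \<and> (\<forall>i < k. m3 OFF i = p0 + i * n)" "m3 VI 0 = k"
      and fr: "\<And>a. a \<noteq> VI \<Longrightarrow> a \<notin> writes ?b2 \<Longrightarrow> m3 a = m2 a"
    then show "runs ?b2 m3 2 (\<lambda>m'. (m'(VI := (m' VI)(0 := Suc k))) POS 0 = p0 + Suc k * n \<and>
      (\<forall>i < Suc k. (m'(VI := (m' VI)(0 := Suc k))) OFF i = p0 + i * n))"
      using nv by (simp add: fr All_less_Suc)
  next
    fix m3 assume off: "m3 POS 0 = p0 + n * n \<and> (\<forall>i < n. m3 OFF i = p0 + i * n)"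
      and fr: "\<And>a. a \<noteq> VI \<Longrightarrow> a \<notin> writes ?b2 \<Longrightarrow> m3 a = m2 a"
    have eqs: "m3 INP = m INP" "m3 CS = m2 CS" "m3 CL = m2 CL" "m3 NV = m2 NV" "m3 HDR = m2 HDR"
      using inp by (simp_all add: fr)
    have "m3 INP (p0 + i * n + j) = bit_cell (A i j)" if "i < n" "j < n" for i j
    proof -
      have "i * n + j < n * n" using that
        mult_le_mono1[of "Suc i" n n] by simp
      then have "p0 + (i * n + j) < length w"
        by (simp add: header_n length_concat_rows)
      moreover have "w ! (p0 + (i * n + j)) = A i j"
        unfolding header_n using nth_concat_rows[OF that, of A] by (simp only: nth_append_length_plus)
      ultimately show ?thesis using m by (simp add: eqs add.assoc)
    qed
    moreover have "m3 CL i = length (encode_nat (c i)) \<and> m3 CL i \<le> l \<and>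
       (\<forall>t < length (encode_nat (c i)). m3 INP (m3 CS i + t) = bit_cell (encode_nat (c i) ! t))"
      if i: "i < n" for i
    proof -
      obtain r where r: "w = header i @ encode_nat (v i) @ encode_nat (c i) @ r" by (rule w_split[OF i])
      have c: "m3 CL i = length (encode_nat (c i))" "m3 CS i = length (header i @ encode_nat (v i))"
        using I i by (simp_all add: eqs)
      have "m3 INP (m3 CS i + t) = bit_cell (encode_nat (c i) ! t)" if t: "t < length (encode_nat (c i))" for t
      proof -
        have "w = (header i @ encode_nat (v i)) @ encode_nat (c i) @ r" using r by simp
        then have "w ! (m3 CS i + t) = encode_nat (c i) ! t" "m3 CS i + t < length w"
          unfolding c using t by (simp_all only: nth_append_length_plus nth_append_left) simp
        then show ?thesis using m by (simp add: eqs)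
      qed
      moreover have "length (encode_nat (c i)) \<le> l" by (simp add: l r)
      ultimately show ?thesis using c by simp
    qed
    moreover have "m3 NV 0 = n" "m3 HDR 0 = length (encode_nat n)" using nv hdr by (simp_all add: eqs)
    ultimately show "?Q m3" using off unfolding env_def by blast
  qed (use I nv n_le in \<open>simp_all add: header_n\<close>)
  have loop1: "runs (For VI NV ?b1) m1 (loop_time l ?T) (\<lambda>m2. runs (For VI NV ?b2) m2 (loop_time l 2) ?Q)"
    if p: "m1 POS 0 = length (header 0)" and inp: "m1 INP = m INP" and nv: "m1 NV 0 = n"
      and hdr: "m1 HDR 0 = length (encode_nat n)" for m1
  proof (rule runs_For[where I = ?I1 and N = n and l = l and T = ?T])
    fix k m2 assume k: "k < n" "m2 VI 0 = k" and I: "?I1 k m2"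
      and fr: "\<And>a. a \<noteq> VI \<Longrightarrow> a \<notin> writes ?b1 \<Longrightarrow> m2 a = m1 a"
    obtain r where r: "w = header k @ encode_nat (v k) @ encode_nat (c k) @ r" by (rule w_split[OF k(1)])
    have inp2: "m2 INP = m INP" using inp by (simp add: fr)
    show "runs ?b1 m2 ?T (\<lambda>m'. ?I1 (Suc k) (m'(VI := (m' VI)(0 := Suc k))))"
    proof (rule runs_Seq, rule runs_frame[OF runs_decode[of w m2 "header k" "v k" "encode_nat (c k) @ r" l]])
      fix m3 assume m3: "m3 ACC 0 = v k \<and> m3 POS 0 = length (header k) + length (encode_nat (v k))"
        and fr3: "\<And>a. a \<notin> writes decode \<Longrightarrow> m3 a = m2 a"
      let ?m = "m3(CS := (m3 CS)(k := m3 POS 0))"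
      have "runs (Seq decode (Write CL (Var VI) (Minus (Var POS) (Read CS (Var VI))))) ?m ((5 * l + 3) + 1)
        (\<lambda>m'. ?I1 (Suc k) (m'(VI := (m' VI)(0 := Suc k))))"
      proof (rule runs_Seq, rule runs_frame[OF runs_decode[of w ?m "header k @ encode_nat (v k)" "c k" r l]])
        fix m4 assume m4: "m4 ACC 0 = c k \<and> m4 POS 0 = length (header k @ encode_nat (v k)) + length (encode_nat (c k))"
          and fr4: "\<And>a. a \<notin> writes decode \<Longrightarrow> m4 a = ?m a"
        show "runs (Write CL (Var VI) (Minus (Var POS) (Read CS (Var VI)))) m4 1
          (\<lambda>m'. ?I1 (Suc k) (m'(VI := (m' VI)(0 := Suc k))))"
          using k I m3 m4 by (simp add: fr4 fr3 All_less_Suc header_Suc)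
      qed (use m m3 r l inp2 in \<open>simp_all add: fr3\<close>)
      then show "runs (Seq (Write CS (Var VI) (Var POS))
          (Seq decode (Write CL (Var VI) (Minus (Var POS) (Read CS (Var VI)))))) m3 (1 + ((5 * l + 3) + 1))
        (\<lambda>m'. ?I1 (Suc k) (m'(VI := (m' VI)(0 := Suc k))))"
        using k by (simp add: fr3)
    qed (use m r l inp2 I in simp_all)
  next
    fix m2 assume I: "?I1 n m2" and fr: "\<And>a. a \<noteq> VI \<Longrightarrow> a \<notin> writes ?b1 \<Longrightarrow> m2 a = m1 a"
    show "runs (For VI NV ?b2) m2 (loop_time l 2) ?Q"
      using inp nv hdr by (intro loop2[OF I]) (simp_all add: fr)
  qed (use p nv n_le in simp_all)
  have w0: "w = [] @ encode_nat n @ concat (map (\<lambda>i. encode_nat (v i) @ encode_nat (c i)) [0..<n]) @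
      concat (map (\<lambda>i. map (A i) [0..<n]) [0..<n])" using w by simp
  show ?thesis unfolding parse_prog_def parse_time_def
  proof (rule runs_Seq, rule runs_frame[OF runs_decode[where w = w and m = m and l = l, OF _ w0]])
    fix m1 assume m1: "m1 ACC 0 = n \<and> m1 POS 0 = length [] + length (encode_nat n)"
      and fr: "\<And>a. a \<notin> writes decode \<Longrightarrow> m1 a = m a"
    have "runs (Seq (For VI NV ?b1) (For VI NV ?b2)) (m1(NV := (m1 NV)(0 := n), HDR := (m1 HDR)(0 := length (encode_nat n))))
      (loop_time l ?T + loop_time l 2) ?Q"
      by (rule runs_Seq, rule loop1) (use m1 in \<open>simp_all add: fr header_def\<close>)
    then show "runs (Seq (Set NV (Var ACC)) (Seq (Set HDR (Var POS)) (Seq (For VI NV ?b1) (For VI NV ?b2)))) m1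
      (2 + (loop_time l ?T + loop_time l 2)) ?Q"
      using m1 by simp
  qed (use m pos l in simp_all)
qed

text \<open>This bounds the output loop. Each color code is a piece of the input, hence of length at
  most l, and n is at most l.\<close>

lemma length_listing_word_le:
  assumes "forced_listing {..<n} A a xs"
  shows "length (listing_word A c xs) \<le> l * l + l * l"
proof -
  have xs: "length xs = n" "set xs = {..<n}"
    using forced_listing_length[OF assms] assms by (simp_all add: forced_listing_def)
  have "length (encode_nat (c i)) \<le> l" if "i < n" for i
    using w_split[OF that] l by (metis length_append trans_le_add1 trans_le_add2 le_refl)
  then have "length (concat (map (\<lambda>x. encode_nat (c x)) xs)) \<le> n * l"
    using length_concat_le[of xs "\<lambda>x. encode_nat (c x)" l] xs by simp
  moreover have "length (concat (map (\<lambda>x. map (A x) xs) xs)) \<le> n * n"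
    using length_concat_le[of xs "\<lambda>x. map (A x) xs" n] xs by simp
  moreover have "n * l \<le> l * l" "n * n \<le> l * l" using n_le by (auto intro: mult_le_mono)
  ultimately show ?thesis unfolding listing_word_def length_append by linarith
qed

lemma words_below_n: "words_below n = listing_words {..<n} A c"
  unfolding words_below_def listing_words_def by auto

lemma runs_output:
  assumes best: "best (words_below n) m" and hdr: "m HDR 0 = length (encode_nat n)"
    and inp: "\<And>i. i < length (encode_nat n) \<Longrightarrow> m INP i = bit_cell (encode_nat n ! i)"
  shows "runs output_prog m (loop_time (l * l + l * l) 1 + 1) (\<lambda>m'. output_is m' (canonical_word {..<n} A c))"
proof -
  let ?h = "length (encode_nat n)"
  obtain u where u: "u = [] \<or> u \<in> words_below n" "\<And>w. w \<in> words_below n \<Longrightarrow> word_value w \<le> word_value u"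
     "m BL 0 = length u" "\<And>i. i < length u \<Longrightarrow> m CAND (m BS 0 + i) = bit_cell (u ! i)"
    using best unfolding best_def by blast
  have len: "length u \<le> l * l + l * l"
    using u(1) length_listing_word_le by (auto simp: words_below_def)
  have "max_word (words_below n) = u"
  proof (cases "words_below n = {}")
    case True then show ?thesis using u(1) by (simp add: max_word_def)
  next
    case False
    \<comment> \<open>If u is empty, maximality bounds all values by 0, so the only word is the
      empty one, and u is in the set after all.\<close>
    then have "u \<in> words_below n" using u(1,2) by fastforce
    then show ?thesis by (rule max_word_eq) (rule u(2))
  qed
  then have canon: "canonical_word {..<n} A c = encode_nat n @ u"
    by (simp add: canonical_word_def words_below_n)
  show ?thesis unfolding output_prog_def
  proof (rule runs_Seq, rule runs_For[where N = "length u" and l = "l * l + l * l" and T = 1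
      and I = "\<lambda>k m'. (\<forall>i < ?h. m' INP i = bit_cell (encode_nat n ! i)) \<and> (\<forall>i < k. m' INP (?h + i) = bit_cell (u ! i))"])
    fix k m1 assume k: "k < length u" "m1 VI 0 = k"
      and I: "(\<forall>i < ?h. m1 INP i = bit_cell (encode_nat n ! i)) \<and> (\<forall>i < k. m1 INP (?h + i) = bit_cell (u ! i))"
      and fr: "\<And>a. a \<noteq> VI \<Longrightarrow> a \<notin> writes (Write INP (Plus (Var HDR) (Var VI)) (Read CAND (Plus (Var BS) (Var VI)))) \<Longrightarrow> m1 a = m a"
    show "runs (Write INP (Plus (Var HDR) (Var VI)) (Read CAND (Plus (Var BS) (Var VI)))) m1 1
      (\<lambda>m'. (\<forall>i < ?h. (m'(VI := (m' VI)(0 := Suc k))) INP i = bit_cell (encode_nat n ! i)) \<and>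
        (\<forall>i < Suc k. (m'(VI := (m' VI)(0 := Suc k))) INP (?h + i) = bit_cell (u ! i)))"
      using I k hdr u(4)[OF k(1)] by (simp add: fr All_less_Suc)
  next
    fix m1 assume I: "(\<forall>i < ?h. m1 INP i = bit_cell (encode_nat n ! i)) \<and> (\<forall>i < length u. m1 INP (?h + i) = bit_cell (u ! i))"
      and fr: "\<And>a. a \<noteq> VI \<Longrightarrow> a \<notin> writes (Write INP (Plus (Var HDR) (Var VI)) (Read CAND (Plus (Var BS) (Var VI)))) \<Longrightarrow> m1 a = m a"
    have "m1 INP i = bit_cell ((encode_nat n @ u) ! i)" if "i < ?h + length u" for i
    proof (cases "i < ?h")
      case False
      then have "i = ?h + (i - ?h)" "i - ?h < length u" using that by auto
      then show ?thesis using I by (metis nth_append_length_plus)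
    qed (use I in \<open>simp add: nth_append\<close>)
    then show "runs (Write INP (Plus (Var HDR) (Var BL)) (Const 0)) m1 1 (\<lambda>m'. output_is m' (canonical_word {..<n} A c))"
      using hdr u(3) unfolding canon output_is_def by (simp add: fr)
  qed (use inp u(3) len in simp_all)
qed

lemma runs_main:
  "runs main_prog (input_memory w) (parse_time l + (search_time l + (loop_time (l * l + l * l) 1 + 1)))
     (\<lambda>m. output_is m (canonical_word {..<n} A c))"
proof -
  let ?m = "input_memory w" and ?Q = "\<lambda>m. output_is m (canonical_word {..<n} A c)"
  have wp: "writes parse_prog = {ACC, POW, POS, NV, HDR, VI, CS, CL, OFF}"
    "writes search_prog = {VA, VI, VJ, REL, VR, VS, VK, GOOD, RANK, PERM, START, VAL, VX, VB, CAND, OUTP, BEST, BS, BL}"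
    by (auto simp: parse_prog_def search_prog_def)
  have inp: "?m INP i = bit_cell (w ! i)" if "i < length w" for i using that by (simp add: input_memory_def)
  show ?thesis unfolding main_prog_def
  proof (rule runs_Seq, rule runs_frame[OF runs_parse])
    fix m1 assume m1: "env m1 \<and> m1 HDR 0 = length (encode_nat n)"
      and fr1: "\<And>a. a \<notin> writes parse_prog \<Longrightarrow> m1 a = ?m a"
    show "runs (Seq search_prog output_prog) m1 (search_time l + (loop_time (l * l + l * l) 1 + 1)) ?Q"
    proof (rule runs_Seq, rule runs_frame[OF runs_search])
      fix m2 assume best: "best (words_below n) m2" and fr2: "\<And>a. a \<notin> writes search_prog \<Longrightarrow> m2 a = m1 a"
      show "runs output_prog m2 (loop_time (l * l + l * l) 1 + 1) ?Q"
      proof (rule runs_output[OF best])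
        fix i assume i: "i < length (encode_nat n)"
        then have "i < length w" "w ! i = encode_nat n ! i" by (auto simp: w nth_append)
        then show "m2 INP i = bit_cell (encode_nat n ! i)" using inp[of i] by (simp add: fr1 fr2 wp)
      qed (use m1 in \<open>simp add: fr2 wp\<close>)
    qed (use m1 in \<open>simp_all add: fr1 wp input_memory_def\<close>)
  qed (use inp in \<open>simp_all add: input_memory_def\<close>)
qed

end

section \<open>The time bound is a polynomial\<close>

definition polynomial_fun :: "(nat \<Rightarrow> nat) \<Rightarrow> bool" where
  "polynomial_fun f \<longleftrightarrow> (\<exists>q. \<forall>x. poly q x = f x)"

lemma polynomial_fun_intros:
  "polynomial_fun (\<lambda>x. x)"
  "polynomial_fun (\<lambda>x. k)"
  "polynomial_fun f \<Longrightarrow> polynomial_fun g \<Longrightarrow> polynomial_fun (\<lambda>x. f x + g x)"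
  "polynomial_fun f \<Longrightarrow> polynomial_fun g \<Longrightarrow> polynomial_fun (\<lambda>x. f x * g x)"
proof -
  show "polynomial_fun (\<lambda>x. x)" unfolding polynomial_fun_def by (rule exI[of _ "[:0, 1:]"]) simp
  show "polynomial_fun (\<lambda>x. k)" unfolding polynomial_fun_def by (rule exI[of _ "[:k:]"]) simp
  show "polynomial_fun f \<Longrightarrow> polynomial_fun g \<Longrightarrow> polynomial_fun (\<lambda>x. f x + g x)"
    unfolding polynomial_fun_def by (metis poly_add)
  show "polynomial_fun f \<Longrightarrow> polynomial_fun g \<Longrightarrow> polynomial_fun (\<lambda>x. f x * g x)"
    unfolding polynomial_fun_def by (metis poly_mult)
qed

lemma polynomial_main_time:
  "polynomial_fun (\<lambda>l. parse_time l + (search_time l + (loop_time (l * l + l * l) 1 + 1)))"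
  unfolding parse_time_def search_time_def candidate_time_def loop_time_def
  by (intro polynomial_fun_intros)

section \<open>Transfer to prime graphs of twin-width at most 1\<close>

abbreviation adjacent :: "'a pair_pre_digraph \<Rightarrow> 'a \<Rightarrow> 'a \<Rightarrow> bool" where
  "adjacent G u v \<equiv> (u, v) \<in> parcs G"

lemma prime_forced_less_total:
  assumes G: "pair_graph G" and prime: "prime_graph G"
    and V: "a \<in> pverts G" "x \<in> pverts G" "y \<in> pverts G" "x \<noteq> y"
  shows "forced_less (pverts G) (adjacent G) a x y \<or> forced_less (pverts G) (adjacent G) a y x"
proof (rule forced_less_total)
  interpret pair_graph G by fact
  show "adjacent G u v \<longleftrightarrow> adjacent G v u" for u v
    using pair_sym_arcs by (auto simp: symmetric_def dest: symD)
  fix M assume "M \<subseteq> pverts G" "M \<noteq> {}"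
    "\<forall>v \<in> pverts G - M. (\<forall>u \<in> M. adjacent G v u) \<or> (\<forall>u \<in> M. \<not> adjacent G v u)"
  then have "is_module G M" unfolding is_module_def by blast
  then show "card M = 1 \<or> M = pverts G" using prime by (auto simp: prime_graph_def trivial_module_def)
qed (use V in auto)

text \<open>For the vertex that is minimal in p, the closure is contained in the strict order of p
  by soundness and is total by primality, so the two coincide. Sorting the vertices by p then gives
  a listing.\<close>

lemma prime_tww1_listing_words:
  assumes X: "prime_tww1 (G, c)" and ne: "pverts G \<noteq> {}"
  shows "listing_words (pverts G) (adjacent G) c \<noteq> {}"
proof -
  let ?V = "pverts G" and ?A = "adjacent G"
  have G: "pair_graph G" and prime: "prime_graph G" and tww: "twin_width G \<le> 1"
    using X by (auto simp: prime_tww1_def)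
  interpret pair_graph G by fact
  have fin: "finite ?V" by simp
  have irr: "\<not> ?A u u" for u using pair_no_loops[of "(u, u)"] by auto
  obtain p q :: "'a \<Rightarrow> int" where inj: "inj_on p ?V" "inj_on q ?V"
    and A: "\<And>u v. u \<in> ?V \<Longrightarrow> v \<in> ?V \<Longrightarrow> u \<noteq> v \<Longrightarrow> ?A u v \<longleftrightarrow> (p u < p v) \<noteq> (q u < q v)"
    using twin_width_le_1_permutation[OF G tww] by blast
  define a where "a = arg_min_on p ?V"
  have a: "a \<in> ?V" "\<And>x. x \<in> ?V \<Longrightarrow> p a \<le> p x"
    using arg_min_if_finite(1)[OF fin ne, of p] arg_min_least[OF fin ne, of _ p] by (auto simp: a_def)
  have less: "forced_less ?V ?A a x y \<longleftrightarrow> p x < p y" if "x \<in> ?V" "y \<in> ?V" for x y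
  proof
    show "forced_less ?V ?A a x y \<Longrightarrow> p x < p y" by (rule forced_less_sound[OF inj A irr a])
    assume xy: "p x < p y"
    then have "x \<noteq> y" by auto
    then have "forced_less ?V ?A a x y \<or> forced_less ?V ?A a y x"
      by (rule prime_forced_less_total[OF G prime a(1) that])
    then show "forced_less ?V ?A a x y" using forced_less_sound[OF inj A irr a, of y x] xy by auto
  qed
  obtain xs where xs: "distinct xs" "set xs = ?V"
    "\<And>i j. i < length xs \<Longrightarrow> j < length xs \<Longrightarrow> p (xs ! i) < p (xs ! j) \<longleftrightarrow> i < j"
    using sorting_list_exists[OF fin inj(1)] by blast
  have "forced_listing ?V ?A a xs"
    unfolding forced_listing_def using xs less nth_mem[of _ xs] by simp
  then show ?thesis using a(1) unfolding listing_words_def by blast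
qed

lemma runs_main_graph:
  fixes G :: "nat pair_pre_digraph"
  assumes X: "prime_tww1 (G, c)"
  defines "l \<equiv> length (encode_graph (G, c))"
  shows "runs main_prog (input_memory (encode_graph (G, c)))
     (parse_time l + (search_time l + (loop_time (l * l + l * l) 1 + 1)))
     (\<lambda>m. output_is m (canonical_word (pverts G) (adjacent G) c))"
proof -
  have G: "pair_graph G" and prime: "prime_graph G" using X by (auto simp: prime_tww1_def)
  interpret pair_graph G by fact
  define vs where "vs = sorted_list_of_set (pverts G)"
  define n where "n = length vs"
  have vs: "distinct vs" "set vs = pverts G" by (simp_all add: vs_def)
  have bij: "bij_betw ((!) vs) {..<n} (pverts G)" using vs by (auto simp: n_def intro: bij_betw_nth)
  let ?A = "\<lambda>i j. adjacent G (vs ! i) (vs ! j)" and ?c = "\<lambda>i. c (vs ! i)"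
  have map_vs: "map f vs = map (\<lambda>i. f (vs ! i)) [0..<n]" for f :: "nat \<Rightarrow> 'b"
    unfolding n_def by (rule nth_equalityI) auto
  have w: "encode_graph (G, c) = encode_nat n @
      concat (map (\<lambda>i. encode_nat (vs ! i) @ encode_nat (?c i)) [0..<n]) @
      concat (map (\<lambda>i. map (?A i) [0..<n]) [0..<n])"
    by (simp only: encode_graph_def Let_def prod.case vs_def[symmetric] n_def[symmetric] map_vs)
  \<comment> \<open>The adjacency matrix alone contributes \<open>n * n\<close> bits to the input,
    so n is bounded by its length.\<close>
  have "n \<le> n * n" by (cases n) auto
  also have "\<dots> \<le> l" unfolding l_def w by (simp add: length_concat_rows)
  finally have n_le: "n \<le> l" .
  interpret E: encoded_graph n l
    "length (encode_nat n @ concat (map (\<lambda>i. encode_nat (vs ! i) @ encode_nat (?c i)) [0..<n]))"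
    ?A ?c "(!) vs" "encode_graph (G, c)"
  proof
    fix a x y assume *: "a < n" "x < n" "y < n" "x \<noteq> y"
    have V: "vs ! a \<in> pverts G" "vs ! x \<in> pverts G" "vs ! y \<in> pverts G" "vs ! x \<noteq> vs ! y"
      using * vs nth_mem[of _ vs] by (auto simp: n_def nth_eq_iff_index_eq)
    have "forced_less (pverts G) (adjacent G) (vs ! a) (vs ! x) (vs ! y) \<longleftrightarrow> forced_less {..<n} ?A a x y"
      "forced_less (pverts G) (adjacent G) (vs ! a) (vs ! y) (vs ! x) \<longleftrightarrow> forced_less {..<n} ?A a y x"
      by (rule forced_less_iso_iff[OF bij]; use * in simp)+
    then show "forced_less {..<n} ?A a x y \<or> forced_less {..<n} ?A a y x"
      using prime_forced_less_total[OF G prime V] by simp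
  qed (rule n_le w refl | simp only: l_def)+
  \<comment> \<open>The program works with positions in the sorted vertex list. Indexing is an
    isomorphism, so it computes the canonical word of the graph itself.\<close>
  have "canonical_word {..<n} ?A ?c = canonical_word (pverts G) (adjacent G) c"
    by (rule canonical_word_iso[OF bij]) auto
  then show ?thesis using E.runs_main by simp
qed

theorem theorem4p5:
  shows "\<exists>I :: nat colored_graph \<Rightarrow> bool list.
    poly_time_computable_on {G. prime_tww1 G} encode_graph I \<and>
    (\<forall>G H. prime_tww1 G \<longrightarrow> prime_tww1 H \<longrightarrow> G \<simeq>\<^sub>c H \<longrightarrow> I G = I H) \<and>
    (\<forall>G H. prime_tww1 G \<longrightarrow> prime_tww1 H \<longrightarrow> I G = I H \<longrightarrow> G \<simeq>\<^sub>c H)"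
proof -
  define I :: "nat colored_graph \<Rightarrow> bool list" where
    "I X = canonical_word (pverts (fst X)) (adjacent (fst X)) (snd X)" for X
  show ?thesis
  proof (intro exI[of _ I] conjI allI impI)
    obtain q where q: "\<And>l. poly q l = parse_time l + (search_time l + (loop_time (l * l + l * l) 1 + 1))"
      using polynomial_main_time unfolding polynomial_fun_def by blast
    have "\<exists>t m. exec main_prog (input_memory (encode_graph X)) t m \<and>
        t \<le> poly q (length (encode_graph X)) \<and> output_is m (I X)" if "prime_tww1 X" for X
      using runs_main_graph[of "fst X" "snd X"] that unfolding runs_def q I_def by simp
    then show "poly_time_computable_on {G. prime_tww1 G} encode_graph I"
      unfolding poly_time_computable_on_def by blast
  next
    fix X Y :: "nat colored_graph" assume "X \<simeq>\<^sub>c Y"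
    then obtain f where "bij_betw f (pverts (fst X)) (pverts (fst Y))"
      "\<forall>u \<in> pverts (fst X). \<forall>v \<in> pverts (fst X). adjacent (fst X) u v \<longleftrightarrow> adjacent (fst Y) (f u) (f v)"
      "\<forall>u \<in> pverts (fst X). snd Y (f u) = snd X u"
      unfolding colored_iso_def by (auto split: prod.splits)
    then show "I X = I Y" unfolding I_def by (intro canonical_word_iso[where f = f]) auto
  next
    fix X Y :: "nat colored_graph" assume XY: "prime_tww1 X" "prime_tww1 Y" and eq: "I X = I Y"
    have fin: "finite (pverts (fst X))" "finite (pverts (fst Y))"
      using XY unfolding prime_tww1_def by (auto dest: pair_graph.axioms(2) pair_pseudo_graph.axioms(1) pair_fin_digraph.pair_finite_verts)
    have ne: "listing_words (pverts (fst Z)) (adjacent (fst Z)) (snd Z) \<noteq> {}"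
      if "prime_tww1 Z" "pverts (fst Z) \<noteq> {}" for Z :: "nat colored_graph"
      using prime_tww1_listing_words[of "fst Z" "snd Z"] that by simp
    show "X \<simeq>\<^sub>c Y"
    proof (rule canonical_word_eqD[OF fin ne[OF XY(1)] ne[OF XY(2)] eq[unfolded I_def]])
      fix f assume f: "bij_betw f (pverts (fst X)) (pverts (fst Y))"
        "\<And>u v. u \<in> pverts (fst X) \<Longrightarrow> v \<in> pverts (fst X) \<Longrightarrow> adjacent (fst X) u v \<longleftrightarrow> adjacent (fst Y) (f u) (f v)"
        "\<And>u. u \<in> pverts (fst X) \<Longrightarrow> snd X u = snd Y (f u)"
      show ?thesis
        unfolding colored_iso_def using f
        by (auto split: prod.splits intro!: exI[of _ f])
    qed
  qed
qed

end
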